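(* Let $(X,\mu)$ be an $m$-coloured stationary uniformly discrete ergodic point process and $w=(w_1,\dots,w_m)\in\mathbb R^m$ a system of weights in which the $w_i$, $i=1,\dots,m$, are all different from one another and none of them is equal to $0$. Then the measure $\mu$ is completely determined by the weighted $(n+1)$-point correlations, $n=1,2,\dots$, of $\mu$-almost surely any $\lambda\in X$. That is: if $(X',\mu')$ is another $m$-coloured stationary uniformly discrete ergodic point process on the same space and, for the same weights $w$ and for every $n\ge1$, the $\mu'$-almost sure $(n+1)$-point correlation of elements of $X'$ equals the $\mu$-almost sure $(n+1)$-point correlation of elements of $X$, then $\mu'=\mu$.
   Context: Fix $d,m\ge1$ and let $\mathbb E=\mathbb R^d\times\{1,\dots,m\}$ (second factor discrete), with $t+(x,i):=(t+x,i)$ for $t\in\mathbb R^d$. $C_R$ is the open cube of edge length $R$ centred at $0$ in $\mathbb R^d$; $\ell$ is Lebesgue measure. $M_p$ is the set of positive Radon measures $\lambda$ on $\mathbb E$ with $\lambda(A)\in\{0,1,2,\dots\}$ for every relatively compact Borel set $A$, with the vague topology ($\lambda_n\to\lambda$ iff $\lambda_n(f)\to\lambda(f)$ for all $f\in C_c(\mathbb E)$) and its Borel $\sigma$-algebra; $\mathbb R^d$ acts by $(T_t\lambda)(A)=\lambda(-t+A)$. For $r>0$, $M_p(C_r^{(m)},1)$ is the (compact) set of $\lambda\in M_p$ with $\lambda((a+C_r)\times\{1,\dots,m\})\le1$ for all $a\in\mathbb R^d$. An $m$-coloured uniformly discrete stationary ergodic point process $(X,\mu)$ is a Borel probability measure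 $\mu$ on $M_p$, invariant and ergodic under all $T_t$, whose support $X$ is a closed subset of $M_p(C_r^{(m)},1)$ for some $r>0$. For $\lambda\in X$ let $\lambda^i$ be the measure on $\mathbb R^d$ given by $\lambda^i(A)=\lambda(A\times\{i\})$; it is assumed throughout that for each $i$ the constant $I^{(i)}$ with $\int_X\lambda^i(A)\,d\mu(\lambda)=I^{(i)}\ell(A)$ is positive. For a system of weights $w\in\mathbb R^m$ put $\lambda^w=\sum_i w_i\lambda^i$ (a signed measure on $\mathbb R^d$). For $n\ge1$, the ($w$-weighted) $(n+1)$-point correlation of $\lambda\in X$ is the measure $\gamma^{(n+1)}_\lambda$ on $(\mathbb R^d)^n$ defined, when the limits exist, by $$\gamma^{(n+1)}_\lambda(f)=\lim_{R\to\infty}\frac1{\ell(C_R)}\sum_{x\in C_R,\;y_1,\dots,y_n\in\mathbb R^d}\lambda^w(\{x\})\prod_{i=1}^n\lambda^w(\{y_i\})\,f(y_1-x,\dots,y_n-x)$$ for all $f\in C_c((\mathbb R^d)^n)$. For each $n$ it exists and is the same measure for $\mu$-almost all $\lambda\in X$. *)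

theory Defs
  imports "HOL-Probability.Probability"
begin

text \<open>The type \<open>'m\<close> of class \<open>{finite, discrete_topology}\<close> plays the role of
  \<open>{1,\<dots>,m}\<close>, with \<open>m = CARD('m)\<close>; likewise \<open>d = CARD('d)\<close>.\<close>

type_synonym ('d, 'm) site = "(real ^ 'd) \<times> 'm"

definition shift :: "real ^ 'd \<Rightarrow> ('d::finite, 'm) site \<Rightarrow> ('d::finite, 'm) site" where
  "shift t p = (t + fst p, snd p)"

definition cube :: "real \<Rightarrow> (real ^ 'd) set" where
  "cube R = {x. \<forall>i. - (R / 2) < x $ i \<and> x $ i < R / 2}"

definition radon_measure :: "'a::topological_space measure \<Rightarrow> bool" where
  "radon_measure M \<longleftrightarrow>
     sets M = sets borel \<and>
     (\<forall>K. compact K \<longrightarrow> emeasure M K < \<infinity>) \<and>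
     (\<forall>A\<in>sets borel. emeasure M A = (SUP K\<in>{K. compact K \<and> K \<in> sets borel \<and> K \<subseteq> A}. emeasure M K))"

definition point_measures :: "('d::finite, 'm::{finite,discrete_topology}) site measure set" where
  "point_measures = {\<xi>. radon_measure \<xi> \<and>
     (\<forall>A\<in>sets borel. compact (closure A) \<longrightarrow> emeasure \<xi> A \<in> \<nat>)}"

definition Cc :: "'a topology \<Rightarrow> ('a \<Rightarrow> real) set" where
  "Cc T = {f. continuous_map T euclideanreal f \<and>
              compactin T (T closure_of {x \<in> topspace T. f x \<noteq> 0})}"

definition vague :: "('d::finite, 'm::{finite,discrete_topology}) site measure topology" where
  "vague = topology_generated_by
     {{\<xi> \<in> point_measures. (\<integral>p. f p \<partial>\<xi>) \<in> U} | f U. f \<in> Cc euclidean \<and> open U}"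

lemma topspace_vague:
  "topspace (vague :: ('d::finite, 'm::{finite,discrete_topology}) site measure topology) = point_measures"
proof -
  have "(point_measures :: ('d, 'm) site measure set) = {\<xi> \<in> point_measures. (\<integral>p. (\<lambda>_. 0) p \<partial>\<xi>) \<in> (UNIV :: real set)}"
    by simp
  moreover have "(\<lambda>_. 0) \<in> Cc (euclidean :: ('d, 'm) site topology)"
    by (simp add: Cc_def)
  ultimately have "(point_measures :: ('d, 'm) site measure set) \<in> {{\<xi> \<in> point_measures. (\<integral>p. f p \<partial>\<xi>) \<in> U} | f U.
      f \<in> Cc (euclidean :: ('d, 'm) site topology) \<and> open U}"
    by blast
  then show ?thesis
    unfolding vague_def topology_generated_by_topspace by blast
qed

definition vague_borel :: "('d::finite, 'm::{finite,discrete_topology}) site measure measure" where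
  "vague_borel = sigma point_measures {U. openin vague U}"

text \<open>The push-forward along \<open>shift t\<close> takes the value \<open>\<xi> (- t + A)\<close> on \<open>A\<close>.\<close>

definition translate ::
    "real ^ 'd \<Rightarrow> ('d::finite, 'm::{finite,discrete_topology}) site measure \<Rightarrow> ('d::finite, 'm) site measure" where
  "translate t \<xi> = distr \<xi> borel (shift t)"

lemma emeasure_translate:
  fixes \<xi> :: "('d::finite, 'm::{finite,discrete_topology}) site measure"
  assumes "sets \<xi> = sets borel" and "A \<in> sets borel"
  shows "emeasure (translate t \<xi>) A = emeasure \<xi> (shift (- t) ` A)"
proof -
  have "continuous_on UNIV (shift t :: ('d::finite, 'm) site \<Rightarrow> _)"
    unfolding shift_def by (intro continuous_intros)
  then have "shift t \<in> measurable \<xi> (borel :: ('d::finite, 'm) site measure)"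
    using borel_measurable_continuous_onI assms(1) measurable_cong_sets by blast
  moreover have "shift t -` A \<inter> space \<xi> = shift (- t) ` A"
    using sets_eq_imp_space_eq[OF assms(1)] by (force simp: shift_def image_iff)
  ultimately show ?thesis
    using assms by (simp add: translate_def emeasure_distr)
qed

definition unif_discrete :: "real \<Rightarrow> ('d::finite, 'm::{finite,discrete_topology}) site measure set" where
  "unif_discrete r = {\<xi> \<in> point_measures. \<forall>a. emeasure \<xi> ((+) a ` cube r \<times> UNIV) \<le> 1}"

text \<open>The measure \<open>\<xi>\<^sup>i\<close> of points of colour \<open>i\<close>.\<close>

definition colour_part ::
    "('d::finite, 'm::{finite,discrete_topology}) site measure \<Rightarrow> 'm \<Rightarrow> (real ^ 'd) measure" where
  "colour_part \<xi> i = distr (restrict_space \<xi> (UNIV \<times> {i})) borel fst"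

lemma emeasure_colour_part:
  fixes \<xi> :: "('d::finite, 'm::{finite,discrete_topology}) site measure"
  assumes "sets \<xi> = sets borel" and "A \<in> sets borel"
  shows "emeasure (colour_part \<xi> i) A = emeasure \<xi> (A \<times> {i})"
proof -
  have sp: "space \<xi> = UNIV"
    using sets_eq_imp_space_eq[OF assms(1)] by simp
  have "open (UNIV \<times> {i} :: ('d::finite, 'm) site set)"
    using open_Times[OF open_UNIV Topological_Spaces.open_discrete] .
  then have S: "(UNIV \<times> {i} :: ('d::finite, 'm) site set) \<in> sets \<xi>"
    using assms(1) by simp
  have "continuous_on UNIV (fst :: ('d::finite, 'm) site \<Rightarrow> _)"
    by (intro continuous_intros)
  then have "fst \<in> measurable \<xi> (borel :: (real ^ 'd) measure)"
    using borel_measurable_continuous_onI assms(1) measurable_cong_sets by blast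
  then have "fst \<in> measurable (restrict_space \<xi> (UNIV \<times> {i})) (borel :: (real ^ 'd) measure)"
    by (rule measurable_restrict_space1)
  moreover have "fst -` A \<inter> space (restrict_space \<xi> (UNIV \<times> {i})) = A \<times> {i}"
    by (auto simp: space_restrict_space sp)
  ultimately have "emeasure (colour_part \<xi> i) A = emeasure (restrict_space \<xi> (UNIV \<times> {i})) (A \<times> {i})"
    using assms by (simp add: colour_part_def emeasure_distr)
  also have "\<dots> = emeasure \<xi> (A \<times> {i})"
    using S by (intro emeasure_restrict_space) (auto simp: sp)
  finally show ?thesis .
qed

definition is_support ::
    "('d::finite, 'm::{finite,discrete_topology}) site measure measure \<Rightarrow> ('d::finite, 'm) site measure set \<Rightarrow> bool" where
  "is_support \<mu> X \<longleftrightarrow>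
     closedin vague X \<and> emeasure \<mu> (point_measures - X) = 0 \<and>
     (\<forall>Y. closedin vague Y \<and> emeasure \<mu> (point_measures - Y) = 0 \<longrightarrow> X \<subseteq> Y)"

definition stationary ::
    "('d::finite, 'm::{finite,discrete_topology}) site measure measure \<Rightarrow> bool" where
  "stationary \<mu> \<longleftrightarrow> (\<forall>t. distr \<mu> \<mu> (translate t) = \<mu>)"

definition ergodic ::
    "('d::finite, 'm::{finite,discrete_topology}) site measure measure \<Rightarrow> bool" where
  "ergodic \<mu> \<longleftrightarrow> (\<forall>A\<in>sets \<mu>. (\<forall>t. translate t -` A \<inter> space \<mu> = A) \<longrightarrow>
     emeasure \<mu> A = 0 \<or> emeasure \<mu> A = 1)"

definition ergodic_point_process ::
    "('d::finite, 'm::{finite,discrete_topology}) site measure set \<Rightarrow> ('d::finite, 'm) site measure measure \<Rightarrow> bool" where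
  "ergodic_point_process X \<mu> \<longleftrightarrow>
     sets \<mu> = sets vague_borel \<and> prob_space \<mu> \<and>
     stationary \<mu> \<and> ergodic \<mu> \<and>
     is_support \<mu> X \<and>
     (\<exists>r>0. closedin (subtopology vague (unif_discrete r)) X) \<and>
     (\<forall>i. \<exists>I>0. \<forall>A\<in>sets borel.
        (\<integral>\<^sup>+\<xi>\<in>X. emeasure (colour_part \<xi> i) A \<partial>\<mu>) = ennreal I * emeasure lborel A)"

text \<open>The signed measure \<open>\<xi>\<^sup>w\<close>; only meaningful on sets where all colour parts are finite.\<close>

definition weighted ::
    "('m \<Rightarrow> real) \<Rightarrow> ('d::finite, 'm::{finite,discrete_topology}) site measure \<Rightarrow> (real ^ 'd) set \<Rightarrow> real" where
  "weighted w \<xi> A = (\<Sum>i\<in>UNIV. w i * measure (colour_part \<xi> i) A)"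

text \<open>Elements of \<open>(\<real>\<^sup>d)\<^sup>n\<close> are functions on \<open>{1..n}\<close>, extended by \<open>undefined\<close> outside.\<close>

abbreviation tuples :: "nat \<Rightarrow> (nat \<Rightarrow> real ^ 'd) topology" where
  "tuples n \<equiv> product_topology (\<lambda>_. euclidean) {1..n}"

text \<open>A signed measure of infinite total variation need not be a set function, so signed Radon
  measures are represented by the linear functionals on \<open>C\<^sub>c\<close> that they induce.\<close>

definition signed_radon :: "'a topology \<Rightarrow> (('a \<Rightarrow> real) \<Rightarrow> real) \<Rightarrow> bool" where
  "signed_radon T \<gamma> \<longleftrightarrow>
     (\<forall>f\<in>Cc T. \<forall>g\<in>Cc T. \<forall>a b. \<gamma> (\<lambda>x. a * f x + b * g x) = a * \<gamma> f + b * \<gamma> g) \<and>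
     (\<forall>K. compactin T K \<longrightarrow> (\<exists>C. \<forall>f\<in>Cc T. \<forall>B.
        (\<forall>x \<in> topspace T - K. f x = 0) \<and> (\<forall>x \<in> topspace T. \<bar>f x\<bar> \<le> B) \<longrightarrow> \<bar>\<gamma> f\<bar> \<le> C * B))"

text \<open>For \<open>\<xi>\<close> in \<open>point_measures\<close> only finitely many terms of the sum below are nonzero.\<close>

definition correlation_average ::
    "('m \<Rightarrow> real) \<Rightarrow> nat \<Rightarrow> ('d::finite, 'm::{finite,discrete_topology}) site measure \<Rightarrow>
     ((nat \<Rightarrow> real ^ 'd) \<Rightarrow> real) \<Rightarrow> real \<Rightarrow> real" where
  "correlation_average w n \<xi> f R =
     1 / measure lborel (cube R :: (real ^ 'd) set) *
     (\<Sum>\<^sub>\<infinity>(x, y) \<in> cube R \<times> ({1..n} \<rightarrow>\<^sub>E UNIV).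
        weighted w \<xi> {x} * (\<Prod>i=1..n. weighted w \<xi> {y i}) * f (\<lambda>i\<in>{1..n}. y i - x))"

text \<open>\<open>has_correlation w n \<xi> \<gamma>\<close>: the \<open>(n+1)\<close>-point correlation of \<open>\<xi>\<close> exists and equals \<open>\<gamma>\<close>.\<close>

definition has_correlation ::
    "('m \<Rightarrow> real) \<Rightarrow> nat \<Rightarrow> ('d::finite, 'm::{finite,discrete_topology}) site measure \<Rightarrow>
     (((nat \<Rightarrow> real ^ 'd) \<Rightarrow> real) \<Rightarrow> real) \<Rightarrow> bool" where
  "has_correlation w n \<xi> \<gamma> \<longleftrightarrow>
     signed_radon (tuples n) \<gamma> \<and>
     (\<forall>f\<in>Cc (tuples n). (correlation_average w n \<xi> f \<longlongrightarrow> \<gamma> f) at_top)"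

end

(* Test the correlations against the overlap volumes
   f(z) = vol (B_0 \<inter> (B_1 - z_1) \<inter> ... \<inter> (B_n - z_n)) of small open boxes.  Writing the volume as an
   integral over t turns the correlation average into the integral over t of
   w(C_R \<inter> (B_0 - t)) w(B_1 - t) ... w(B_n - t), where w(A) is the weighted mass of A.  By
   stationarity and Fubini its expectation is, for every R without any boundary term, that of
   w(B_0) ... w(B_n), so dominated convergence identifies the correlation with this moment.
   A small box carries at most one point, so w(B)
   is 0 or one of the distinct nonzero weights, and Lagrange interpolation writes the indicator of
   'B contains a point of colour i' as a polynomial in w(B).  Hence the joint hitting probabilities
   of small coloured boxes are determined; these hitting events are stable under intersection and
   generate the Borel sets of the vague topology on uniformly discrete configurations. *)

theory Submission
  imports Defs
begin

section \<open>Point measures and their atoms\<close>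

text \<open>Correlations are given only on continuous test functions of compact support, whereas the
  moments to be recovered concern box indicators, which are discontinuous. Integrating a product of
  box indicators over all common translates produces an overlap volume, which is an admissible test
  function, and by stationarity this averaging loses nothing of the moment. The almost sure limit is
  a constant, so its expectation is the correlation itself. Passing to the limit needs averages
  bounded uniformly in R; this is one reason to restrict to small boxes, whose weighted mass is at
  most the sum of the |w i|. The other is that their mass reveals the colour: a zero weight could
  not be told from an empty box, nor could equal weights be told from each other. Two processes may
  have different supports and different hard-core distances, so both are placed on the union of the
  supports, with the smaller distance.\<close>

lemma Times_colour_borel:
  fixes A :: "(real ^ 'd::finite) set" and i :: "'m::{finite,discrete_topology}"
  assumes "A \<in> sets borel"
  shows "A \<times> {i} \<in> sets borel"
proof -
  have "open (UNIV \<times> {i} :: ('d, 'm) site set)"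
    by (intro open_Times Topological_Spaces.open_discrete open_UNIV)
  moreover have "fst \<in> borel_measurable (borel :: ('d, 'm) site measure)"
    by (intro borel_measurable_continuous_onI continuous_intros)
  then have "fst -` A \<inter> space (borel :: ('d, 'm) site measure) \<in> sets borel"
    using assms by (rule measurable_sets)
  ultimately have "(fst -` A \<inter> UNIV) \<inter> (UNIV \<times> {i} :: ('d, 'm) site set) \<in> sets borel"
    by auto
  also have "(fst -` A \<inter> UNIV) \<inter> (UNIV \<times> {i} :: ('d, 'm) site set) = A \<times> {i}"
    by auto
  finally show ?thesis .
qed

lemma point_measuresD:
  assumes "\<xi> \<in> point_measures"
  shows sets_point_measure: "sets \<xi> = sets borel"
    and space_point_measure: "space \<xi> = UNIV"
    and finite_compact_point_measure: "compact K \<Longrightarrow> emeasure \<xi> K < \<infinity>"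
    and nat_point_measure: "\<lbrakk>A \<in> sets borel; A \<subseteq> K; compact K\<rbrakk> \<Longrightarrow> emeasure \<xi> A \<in> \<nat>"
proof -
  show s: "sets \<xi> = sets borel"
    using assms by (simp add: point_measures_def radon_measure_def)
  show "space \<xi> = UNIV"
    using sets_eq_imp_space_eq[OF s] by simp
  show "compact K \<Longrightarrow> emeasure \<xi> K < \<infinity>"
    using assms by (simp add: point_measures_def radon_measure_def)
  show "emeasure \<xi> A \<in> \<nat>" if "A \<in> sets borel" "A \<subseteq> K" "compact K"
  proof -
    have "closure A \<subseteq> K"
      using that compact_imp_closed closure_minimal by blast
    then have "compact (closure A)"
      using that by (metis closed_closure compact_Int_closed inf.absorb_iff2)
    then show ?thesis
      using assms that by (simp add: point_measures_def)
  qed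
qed

lemma Nats_ennreal_less_1: "x \<in> \<nat> \<Longrightarrow> x < 1 \<Longrightarrow> x = (0::ennreal)"
  by (auto simp: Nats_def of_nat_less_1_iff)

text \<open>Punctured balls around a point decrease to the empty set inside a set of finite mass, so
  their masses tend to 0. Masses are natural numbers, hence one of them is already 0.\<close>

lemma point_measure_isolated:
  fixes \<xi> :: "('d::finite, 'm::{finite,discrete_topology}) site measure"
  assumes "\<xi> \<in> point_measures"
  shows "\<exists>e>0. emeasure \<xi> (ball x e \<times> {i} - {(x, i)}) = 0"
proof -
  define U where "U n = ball x (1 / (1 + real n)) \<times> {i} - {(x, i)}" for n
  have Ub: "U n \<in> sets borel" for n
    unfolding U_def by (intro sets.Diff Times_colour_borel) auto
  have cpt: "compact (cball x 1 \<times> {i})"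
    by (intro compact_Times) auto
  have sub: "U n \<subseteq> cball x 1 \<times> {i}" for n
  proof -
    have "1 / (1 + real n) \<le> 1" by simp
    then have "ball x (1 / (1 + real n)) \<subseteq> cball x 1"
      by (meson ball_subset_cball order_trans subset_ball)
    then show ?thesis unfolding U_def by blast
  qed
  have "(INF n. emeasure \<xi> (U n)) = emeasure \<xi> (\<Inter>n. U n)"
  proof (rule INF_emeasure_decseq)
    show "range U \<subseteq> sets \<xi>"
      using Ub sets_point_measure[OF assms] by auto
    show "decseq U"
      unfolding decseq_def U_def
    proof (intro allI impI Diff_mono Sigma_mono subset_ball order_refl)
      fix m n :: nat assume "m \<le> n"
      then show "1 / (1 + real n) \<le> 1 / (1 + real m)" by (simp add: frac_le)
    qed
    show "emeasure \<xi> (U n) \<noteq> \<infinity>" for n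
      using emeasure_mono[OF sub, of \<xi> n] finite_compact_point_measure[OF assms cpt]
        sets_point_measure[OF assms] cpt by (auto simp: top_unique borel_compact)
  qed
  also have "(\<Inter>n. U n) = {}"
  proof (rule ccontr)
    assume "(\<Inter>n. U n) \<noteq> {}"
    then obtain p where p: "\<And>n. p \<in> U n" by auto
    define y where "y = fst p"
    have y: "(y, i) \<in> U n" for n using p[of n] by (auto simp: U_def y_def)
    then have "dist x y > 0" using y[of 0] by (auto simp: U_def)
    then obtain n where "inverse (real (Suc n)) < dist x y"
      using reals_Archimedean by blast
    moreover have "dist x y < 1 / (1 + real n)" using y[of n] by (auto simp: U_def)
    ultimately show False by (simp add: field_simps)
  qed
  finally have "(INF n. emeasure \<xi> (U n)) < 1" by simp
  then obtain n where "emeasure \<xi> (U n) < 1" by (auto simp: INF_less_iff)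
  then have "emeasure \<xi> (U n) = 0"
    using Nats_ennreal_less_1 nat_point_measure[OF assms Ub sub cpt] by blast
  then show ?thesis
    unfolding U_def by (intro exI[of _ "1 / (1 + real n)"]) auto
qed

text \<open>Cover K by the neighbourhoods of the preceding lemma and keep the centres of a finite
  subcover. The set F may contain points of mass 0, which contribute nothing to sums over
  atoms.\<close>

lemma point_measure_finite_atoms:
  fixes \<xi> :: "('d::finite, 'm::{finite,discrete_topology}) site measure"
  assumes "\<xi> \<in> point_measures" "compact K"
  obtains F where "finite F" "F \<subseteq> K" "emeasure \<xi> (K - F) = 0"
proof -
  have "\<forall>p. \<exists>e>0. emeasure \<xi> (ball (fst p) e \<times> {snd p} - {p}) = 0"
    using point_measure_isolated[OF assms(1)] by simp
  then obtain e where e: "\<And>p. e p > 0" "\<And>p. emeasure \<xi> (ball (fst p) (e p) \<times> {snd p} - {p}) = 0"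
    by metis
  have "\<exists>D\<subseteq>K. finite D \<and> K \<subseteq> (\<Union>p\<in>D. ball (fst p) (e p) \<times> {snd p})"
  proof (rule compactE_image[OF assms(2)])
    show "open (ball (fst p) (e p) \<times> {snd p})" for p
      by (intro open_Times Topological_Spaces.open_discrete open_ball)
    show "K \<subseteq> (\<Union>p\<in>K. ball (fst p) (e p) \<times> {snd p})"
      using e(1) by force
  qed blast
  then obtain D where D: "D \<subseteq> K" "finite D" "K \<subseteq> (\<Union>p\<in>D. ball (fst p) (e p) \<times> {snd p})"
    by blast
  have null: "(\<Union>p\<in>D. ball (fst p) (e p) \<times> {snd p} - {p}) \<in> null_sets \<xi>"
    using D(2) e(2) sets_point_measure[OF assms(1)]
    by (intro null_sets_UN' countable_finite) (auto simp: null_sets_def intro!: Times_colour_borel sets.Diff)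
  have "K - D \<subseteq> (\<Union>p\<in>D. ball (fst p) (e p) \<times> {snd p} - {p})"
    using D(3) by blast
  with null have "emeasure \<xi> (K - D) = 0"
    using emeasure_eq_0 null_setsD1 null_setsD2 by blast
  then show thesis using that D by blast
qed

lemma measure_point_measure_atoms:
  fixes \<xi> :: "('d::finite, 'm::{finite,discrete_topology}) site measure"
  assumes \<xi>: "\<xi> \<in> point_measures" and K: "compact K"
    and F: "finite F" "F \<subseteq> K" "emeasure \<xi> (K - F) = 0"
    and A: "A \<in> sets borel" "A \<subseteq> K"
  shows "measure \<xi> A = (\<Sum>p\<in>F \<inter> A. measure \<xi> {p})"
proof -
  note [simp] = sets_point_measure[OF \<xi>]
  have pt: "{p} \<in> sets borel" for p :: "('d, 'm) site"
    by (simp add: borel_closed)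
  have Kb: "K \<in> sets borel" using K by (rule borel_compact)
  have FA: "F \<inter> A \<in> sets borel"
    using F(1) by (intro borel_closed finite_imp_closed) simp
  have fin: "emeasure \<xi> B \<noteq> \<infinity>" if "B \<subseteq> K" for B
    using emeasure_mono[OF that, of \<xi>] finite_compact_point_measure[OF \<xi> K] Kb by (auto simp: top_unique)
  have "emeasure \<xi> (A - F) = 0"
  proof -
    have "F \<in> sets borel" using F(1) by (intro borel_closed finite_imp_closed) simp
    then have "emeasure \<xi> (A - F) \<le> emeasure \<xi> (K - F)"
      using Kb A by (intro emeasure_mono) auto
    then show ?thesis using F(3) by simp
  qed
  moreover have "A - (F \<inter> A) = A - F" by blast
  ultimately have "A - (F \<inter> A) \<in> null_sets \<xi>"
    using A(1) borel_closed[OF finite_imp_closed[OF F(1)]] by (simp add: null_sets_def sets.Diff)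
  then have "emeasure \<xi> A = emeasure \<xi> (F \<inter> A)"
    using A FA by (metis emeasure_Un_null_set Int_lower2 Un_Diff_cancel Un_absorb1 \<open>sets \<xi> = sets borel\<close>)
  then have "measure \<xi> A = measure \<xi> (F \<inter> A)"
    by (simp add: measure_def)
  also have "\<dots> = (\<Sum>p\<in>F \<inter> A. measure \<xi> {p})"
    using F pt fin by (intro measure_eq_sum_singleton) auto
  finally show ?thesis .
qed

section \<open>Small boxes and their weighted mass\<close>

lemma cube_eq_box: "cube R = box (\<chi> i. - (R / 2)) (\<chi> i. R / 2)"
  by (auto simp: cube_def mem_box_cart)

lemma open_cube: "open (cube R)"
  by (simp add: cube_eq_box open_box)

lemma box_subset_translated_cube:
  assumes "\<And>k. b $ k - a $ k \<le> r"
  shows "\<exists>c. box a b \<subseteq> (+) c ` cube r"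
proof -
  define c where "c = (1 / 2) *\<^sub>R (a + b)"
  have "box a b \<subseteq> (+) c ` cube r"
  proof
    fix x assume x: "x \<in> box a b"
    have "x - c \<in> cube r"
      unfolding cube_def
    proof (intro CollectI allI conjI)
      fix k
      have "a $ k < x $ k" "x $ k < b $ k" using x by (auto simp: mem_box_cart)
      then show "- (r / 2) < (x - c) $ k" "(x - c) $ k < r / 2"
        using assms[of k] by (auto simp: c_def field_simps)
    qed
    then show "x \<in> (+) c ` cube r" by (rule rev_image_eqI) simp
  qed
  then show ?thesis by blast
qed

lemma emeasure_small_le_1:
  fixes \<xi> :: "('d::finite, 'm::{finite,discrete_topology}) site measure"
  assumes "\<xi> \<in> unif_discrete r" "B \<subseteq> (+) c ` cube r \<times> UNIV"
  shows "emeasure \<xi> B \<le> 1"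
proof -
  have s: "sets \<xi> = sets borel"
    using assms(1) sets_point_measure unfolding unif_discrete_def by blast
  have "open ((+) c ` cube r \<times> UNIV :: ('d, 'm) site set)"
    by (intro open_Times open_translation open_cube open_UNIV)
  then have "emeasure \<xi> B \<le> emeasure \<xi> ((+) c ` cube r \<times> UNIV)"
    using assms(2) s by (intro emeasure_mono) auto
  also have "\<dots> \<le> 1" using assms(1) by (auto simp: unif_discrete_def)
  finally show ?thesis .
qed

lemma Nats_ennreal_le_1: "x \<in> \<nat> \<Longrightarrow> x \<le> 1 \<Longrightarrow> x = 0 \<or> x = (1::ennreal)"
  using Nats_ennreal_less_1 by fastforce

lemma box_times_subset_compact: "box a b \<times> I \<subseteq> cbox a b \<times> (UNIV :: 'm::{finite,discrete_topology} set)"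
  using box_subset_cbox by blast

text \<open>The hard-core condition bounds the mass of a cube taken over all colours at once. Hence
  two colours in the same small box together still have mass at most 1, and integrality leaves only
  0 and 1.\<close>

lemma emeasure_small_box:
  fixes \<xi> :: "('d::finite, 'm::{finite,discrete_topology}) site measure"
  assumes \<xi>: "\<xi> \<in> unif_discrete r" and small: "\<And>k. b $ k - a $ k \<le> r"
  shows "emeasure \<xi> (box a b \<times> {i}) = 0 \<or> emeasure \<xi> (box a b \<times> {i}) = 1"
    and "\<lbrakk>emeasure \<xi> (box a b \<times> {i}) \<noteq> 0; j \<noteq> i\<rbrakk> \<Longrightarrow> emeasure \<xi> (box a b \<times> {j}) = 0"
proof -
  have pm: "\<xi> \<in> point_measures" using \<xi> by (simp add: unif_discrete_def)
  obtain c where c: "box a b \<subseteq> (+) c ` cube r"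
    using box_subset_translated_cube small by meson
  have cpt: "compact (cbox a b \<times> (UNIV :: 'm set))"
    by (intro compact_Times compact_cbox finite_imp_compact) simp
  have bor: "box a b \<times> {i} \<in> sets borel" for i :: 'm
    by (intro Times_colour_borel) simp
  show *: "emeasure \<xi> (box a b \<times> {i}) = 0 \<or> emeasure \<xi> (box a b \<times> {i}) = 1" for i
    using c by (intro Nats_ennreal_le_1 nat_point_measure[OF pm bor box_times_subset_compact cpt]
      emeasure_small_le_1[OF \<xi>, where c = c]) auto
  assume ne: "emeasure \<xi> (box a b \<times> {i}) \<noteq> 0" "j \<noteq> i"
  have "emeasure \<xi> (box a b \<times> {i} \<union> box a b \<times> {j}) = emeasure \<xi> (box a b \<times> {i}) + emeasure \<xi> (box a b \<times> {j})"
    using bor ne sets_point_measure[OF pm] by (intro plus_emeasure[symmetric]) auto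
  moreover have "emeasure \<xi> (box a b \<times> {i} \<union> box a b \<times> {j}) \<le> 1"
    using c by (intro emeasure_small_le_1[OF \<xi>, where c = c]) auto
  moreover have "\<not> (1 + 1 \<le> (1::ennreal))" by (simp add: not_le)
  ultimately show "emeasure \<xi> (box a b \<times> {j}) = 0"
    using *[of i] *[of j] ne(1) by metis
qed

lemma weighted_eq:
  fixes \<xi> :: "('d::finite, 'm::{finite,discrete_topology}) site measure"
  assumes "\<xi> \<in> point_measures" "A \<in> sets borel"
  shows "weighted w \<xi> A = (\<Sum>i\<in>UNIV. w i * measure \<xi> (A \<times> {i}))"
  by (simp add: weighted_def measure_def emeasure_colour_part[OF sets_point_measure[OF assms(1)] assms(2)])

lemma weighted_small_box:
  fixes \<xi> :: "('d::finite, 'm::{finite,discrete_topology}) site measure"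
  assumes \<xi>: "\<xi> \<in> unif_discrete r" and small: "\<And>k. b $ k - a $ k \<le> r"
  shows "emeasure \<xi> (box a b \<times> {i}) \<noteq> 0 \<Longrightarrow> weighted w \<xi> (box a b) = w i"
    and "(\<And>i. emeasure \<xi> (box a b \<times> {i}) = 0) \<Longrightarrow> weighted w \<xi> (box a b) = 0"
proof -
  have pm: "\<xi> \<in> point_measures" using \<xi> by (simp add: unif_discrete_def)
  note w = weighted_eq[OF pm, of "box a b" w, simplified]
  show "weighted w \<xi> (box a b) = 0" if "\<And>i. emeasure \<xi> (box a b \<times> {i}) = 0"
    using that by (simp add: w measure_def)
  assume i: "emeasure \<xi> (box a b \<times> {i}) \<noteq> 0"
  have "w j * measure \<xi> (box a b \<times> {j}) = (if j = i then w i else 0)" for j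
    using emeasure_small_box(1)[OF \<xi> small, of i] emeasure_small_box(2)[OF \<xi> small, of i j] i
    by (auto simp: measure_def)
  then show "weighted w \<xi> (box a b) = w i"
    by (simp add: w)
qed

lemma abs_weighted_small_box_le:
  fixes \<xi> :: "('d::finite, 'm::{finite,discrete_topology}) site measure"
  assumes \<xi>: "\<xi> \<in> unif_discrete r" and small: "\<And>k. b $ k - a $ k \<le> r"
  shows "\<bar>weighted w \<xi> (box a b)\<bar> \<le> (\<Sum>i\<in>UNIV. \<bar>w i\<bar>)"
proof (cases "\<exists>i. emeasure \<xi> (box a b \<times> {i}) \<noteq> 0")
  case True
  then obtain i where "weighted w \<xi> (box a b) = w i"
    using weighted_small_box(1)[OF \<xi> small] by blast
  then show ?thesis using member_le_sum[of i UNIV "\<lambda>i. \<bar>w i\<bar>"] by simp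
next
  case False
  then show ?thesis using weighted_small_box(2)[OF \<xi> small, of w] by (simp add: sum_nonneg)
qed

text \<open>This is what lets two processes with different hard-core distances be treated with the
  smaller of the two.\<close>

lemma unif_discrete_mono:
  assumes "r \<le> s"
  shows "(unif_discrete s :: ('d::finite, 'm::{finite,discrete_topology}) site measure set) \<subseteq> unif_discrete r"
proof
  fix \<xi> :: "('d, 'm) site measure" assume \<xi>: "\<xi> \<in> unif_discrete s"
  have "cube r \<subseteq> (cube s :: (real ^ 'd) set)"
  proof -
    have "- (s / 2) \<le> - (r / 2)" "r / 2 \<le> s / 2" using assms by simp_all
    then show ?thesis
      unfolding cube_def by (blast intro: le_less_trans less_le_trans)
  qed
  then have "(+) a ` cube r \<times> UNIV \<subseteq> (+) a ` cube s \<times> (UNIV :: 'm set)" for a :: "real ^ 'd"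
    by blast
  then have "emeasure \<xi> ((+) a ` cube r \<times> UNIV) \<le> 1" for a
    using emeasure_small_le_1[OF \<xi>] by blast
  then show "\<xi> \<in> unif_discrete r" using \<xi> by (simp add: unif_discrete_def)
qed

section \<open>Measurability and translations\<close>

lemma space_vague_borel: "space vague_borel = point_measures"
  by (simp add: vague_borel_def space_measure_of_conv)

lemma sets_vague_borel: "sets vague_borel = sigma_sets point_measures {U. openin vague U}"
  unfolding vague_borel_def
  by (rule sets_measure_of) (use openin_subset topspace_vague in blast)

lemma openin_vague_integral:
  assumes "f \<in> Cc euclidean" "open U"
  shows "openin vague {\<xi> \<in> point_measures. (\<integral>p. f p \<partial>\<xi>) \<in> U}"
  unfolding vague_def by (rule topology_generated_by_Basis) (use assms in blast)

lemma borel_measurable_Cc_integral: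
  assumes "f \<in> Cc euclidean"
  shows "(\<lambda>\<xi>. \<integral>p. f p \<partial>\<xi>) \<in> borel_measurable vague_borel"
proof (rule borel_measurableI)
  fix S :: "real set" assume "open S"
  from openin_vague_integral[OF assms this]
  have "{\<xi> \<in> point_measures. (\<integral>p. f p \<partial>\<xi>) \<in> S} \<in> sets vague_borel"
    by (simp add: sets_vague_borel)
  also have "{\<xi> \<in> point_measures. (\<integral>p. f p \<partial>\<xi>) \<in> S} = (\<lambda>\<xi>. \<integral>p. f p \<partial>\<xi>) -` S \<inter> space vague_borel"
    by (auto simp: space_vague_borel)
  finally show "(\<lambda>\<xi>. \<integral>p. f p \<partial>\<xi>) -` S \<inter> space vague_borel \<in> sets vague_borel" .
qed

lemma Cc_euclideanI:
  fixes f :: "'a::t2_space \<Rightarrow> real"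
  assumes "continuous_on UNIV f" "compact K" "\<And>x. x \<notin> K \<Longrightarrow> f x = 0"
  shows "f \<in> Cc euclidean"
proof -
  have "closure {x. f x \<noteq> 0} \<subseteq> K"
    using assms compact_imp_closed by (intro closure_minimal) auto
  then have "compact (closure {x. f x \<noteq> 0})"
    using assms(2) by (metis closed_closure compact_Int_closed inf.absorb_iff2)
  then show ?thesis
    using assms(1) by (simp add: Cc_def continuous_map_iff_continuous2 euclidean_closure_of)
qed

lemma Cc_euclideanD:
  fixes f :: "'a::t2_space \<Rightarrow> real"
  assumes "f \<in> Cc euclidean"
  shows "continuous_on UNIV f" and "compact (closure {x. f x \<noteq> 0})"
  using assms by (simp_all add: Cc_def continuous_map_iff_continuous2 euclidean_closure_of)

lemma continuous_on_discrete_UNIV: "continuous_on UNIV (f :: 'a::discrete_topology \<Rightarrow> 'b::topological_space)"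
  by (simp add: continuous_on_open_vimage Topological_Spaces.open_discrete)

text \<open>Integrals of continuous functions of compact support are measurable by the definition of
  the vague topology. The indicator of an open box is the increasing limit of such functions, namely
  truncated multiples of the distance to the complement, and the colour indicator is continuous
  because the colours are discrete.\<close>

lemma borel_measurable_fixed_box_count:
  fixes a b :: "real ^ 'd::finite" and i :: "'m::{finite,discrete_topology}"
  shows "(\<lambda>\<xi>. emeasure \<xi> (box a b \<times> {i})) \<in> borel_measurable vague_borel"
proof -
  define c where "c j = (if j = i then 1 else 0 :: real)" for j
  define h where "h n p = min 1 (real n * infdist (fst p) (- box a b)) * c (snd p)" for n and p :: "('d, 'm) site"
  \<comment> \<open>\<open>infdist\<close> to the empty set is 0 by convention, so the equivalence
    below relies on the complement being nonempty.\<close>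
  have ne: "- box a b \<noteq> {}"
    by (metis bounded_box not_bounded_UNIV boolean_algebra_class.boolean_algebra.double_compl compl_bot_eq)
  have zero: "infdist x (- box a b) = 0 \<longleftrightarrow> x \<notin> box a b" for x
    using in_closed_iff_infdist_zero[OF _ ne, of x] open_box[of a b] by (auto simp: closed_Compl)
  have h0: "h n p = 0" if "p \<notin> cbox a b \<times> {i}" for n p
    using that zero[of "fst p"] box_subset_cbox by (cases p) (auto simp: h_def c_def)
  have h_nonneg: "0 \<le> h n p" for n p
    by (simp add: h_def c_def infdist_nonneg)
  have cont: "continuous_on UNIV (h n)" for n
  proof -
    have "continuous_on UNIV (\<lambda>p :: ('d, 'm) site. c (snd p))"
      by (rule continuous_on_compose2[OF continuous_on_discrete_UNIV continuous_on_snd]) (auto intro: continuous_on_id)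
    then show ?thesis unfolding h_def by (intro continuous_intros)
  qed
  have cpt: "compact (cbox a b \<times> {i})"
    by (intro compact_Times) auto
  have meas: "(\<lambda>\<xi>. \<integral>p. h n p \<partial>\<xi>) \<in> borel_measurable vague_borel" for n
    using cont cpt h0 by (intro borel_measurable_Cc_integral Cc_euclideanI)
  have sup: "(SUP n. ennreal (h n p)) = indicator (box a b \<times> {i}) p" for p
  proof (cases "p \<in> box a b \<times> {i}")
    case True
    then have pos: "infdist (fst p) (- box a b) > 0"
      using zero[of "fst p"] infdist_nonneg[of "fst p" "- box a b"] by force
    then obtain n where "real n * infdist (fst p) (- box a b) > 1"
      using reals_Archimedean3 by blast
    then have "h n p = 1" using True by (auto simp: h_def c_def)
    then have "1 \<le> (SUP n. ennreal (h n p))" by (metis SUP_upper UNIV_I ennreal_1)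
    moreover have "(SUP n. ennreal (h n p)) \<le> 1"
      by (intro SUP_least) (auto simp: h_def c_def ennreal_le_1)
    ultimately show ?thesis using True by simp
  next
    case False
    then have "h n p = 0" for n using zero[of "fst p"] by (cases p) (auto simp: h_def c_def)
    then show ?thesis using False by simp
  qed
  have "emeasure \<xi> (box a b \<times> {i}) = (SUP n. ennreal (\<integral>p. h n p \<partial>\<xi>))" if \<xi>: "\<xi> \<in> point_measures" for \<xi>
  proof -
    note [simp] = sets_point_measure[OF \<xi>] 
    have B: "box a b \<times> {i} \<in> sets borel"
      by (intro Times_colour_borel) simp
    have hm: "h n \<in> borel_measurable \<xi>" for n
      using borel_measurable_continuous_onI[OF cont] by (simp cong: measurable_cong_sets)
    have "emeasure \<xi> (box a b \<times> {i}) = (\<integral>\<^sup>+p. (SUP n. ennreal (h n p)) \<partial>\<xi>)"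
      using B by (simp add: sup)
    also have "\<dots> = (SUP n. \<integral>\<^sup>+p. ennreal (h n p) \<partial>\<xi>)"
    proof (rule nn_integral_monotone_convergence_SUP)
      show "incseq (\<lambda>n p. ennreal (h n p))"
        unfolding incseq_def le_fun_def h_def
        by (intro allI impI ennreal_leI mult_right_mono min.mono order_refl) (auto simp: infdist_nonneg c_def)
    qed (use hm in simp)
    also have "\<dots> = (SUP n. ennreal (\<integral>p. h n p \<partial>\<xi>))"
    proof (rule SUP_cong[OF refl])
      fix n
      \<comment> \<open>A finite upper bound is what allows the extended nonnegative integral to be
        replaced by the real one.\<close>
      have "(\<integral>\<^sup>+p. ennreal (h n p) \<partial>\<xi>) \<le> (\<integral>\<^sup>+p. indicator (box a b \<times> {i}) p \<partial>\<xi>)"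
        by (intro nn_integral_mono) (metis sup SUP_upper UNIV_I)
      also have "\<dots> \<le> emeasure \<xi> (cbox a b \<times> {i})"
        using B box_subset_cbox[of a b] borel_compact[OF cpt] by (auto intro!: emeasure_mono)
      also have "\<dots> < \<infinity>" using finite_compact_point_measure[OF \<xi> cpt] .
      finally show "(\<integral>\<^sup>+p. ennreal (h n p) \<partial>\<xi>) = ennreal (\<integral>p. h n p \<partial>\<xi>)"
        using hm h_nonneg by (simp add: integral_eq_nn_integral)
    qed
    finally show ?thesis .
  qed
  then show ?thesis
    using meas by (subst measurable_cong[where g = "\<lambda>\<xi>. SUP n. ennreal (\<integral>p. h n p \<partial>\<xi>)"])
      (auto simp: space_vague_borel)
qed

section \<open>Boxes with varying endpoints\<close>

definition rational_vectors :: "(real ^ 'd::finite) set" where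
  "rational_vectors = range (\<lambda>f :: 'd \<Rightarrow> rat. \<chi> k. of_rat (f k))"

lemma countable_rational_vectors: "countable rational_vectors"
  by (simp add: rational_vectors_def)

lemma rational_vector_between:
  fixes u v :: "'d::finite \<Rightarrow> real"
  assumes "\<And>k. u k < v k"
  shows "\<exists>q\<in>rational_vectors. \<forall>k. u k < q $ k \<and> q $ k < v k"
proof -
  have "\<forall>k. \<exists>q. u k < of_rat q \<and> of_rat q < v k"
    using of_rat_dense[OF assms] by blast
  then obtain f where f: "\<forall>k. u k < of_rat (f k) \<and> of_rat (f k) < v k" by metis
  then show ?thesis
    unfolding rational_vectors_def by (intro bexI[of _ "\<chi> k. of_rat (f k)"]) auto
qed

text \<open>On a nonempty compact set every coordinate attains its extremes, strictly inside the
  open box, which leaves room for rational endpoints on both sides.\<close>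

lemma compact_in_rational_box:
  fixes a b :: "real ^ 'd::finite"
  assumes "compact L" "L \<subseteq> box a b" "L \<noteq> {}"
  obtains c d where "c \<in> rational_vectors" "d \<in> rational_vectors" "L \<subseteq> box c d"
    "\<And>k. a $ k \<le> c $ k" "\<And>k. d $ k \<le> b $ k"
proof -
  have "\<exists>u v. a $ k < u \<and> v < b $ k \<and> (\<forall>x\<in>L. u \<le> x $ k \<and> x $ k \<le> v)" for k
  proof -
    have c: "continuous_on L (\<lambda>x. x $ k)" by (intro continuous_intros)
    obtain x y where "x \<in> L" "\<forall>z\<in>L. x $ k \<le> z $ k" "y \<in> L" "\<forall>z\<in>L. z $ k \<le> y $ k"
      using continuous_attains_inf[OF assms(1,3) c] continuous_attains_sup[OF assms(1,3) c] by blast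
    moreover from this have "a $ k < x $ k" "y $ k < b $ k" using assms(2) by (auto simp: mem_box_cart)
    ultimately show ?thesis by blast
  qed
  then obtain u v where uv: "\<And>k. a $ k < u k" "\<And>k. v k < b $ k" "\<And>k x. x \<in> L \<Longrightarrow> u k \<le> x $ k \<and> x $ k \<le> v k"
    by metis
  obtain c where c: "c \<in> rational_vectors" "\<forall>k. a $ k < c $ k \<and> c $ k < u k"
    using rational_vector_between[of "\<lambda>k. a $ k" u] uv(1) by blast
  obtain d where d: "d \<in> rational_vectors" "\<forall>k. v k < d $ k \<and> d $ k < b $ k"
    using rational_vector_between[of v "\<lambda>k. b $ k"] uv(2) by blast
  have "L \<subseteq> box c d"
    unfolding mem_box_cart subset_iff using uv(3) c(2) d(2) by (meson less_le_trans le_less_trans)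
  then show thesis using c d by (intro that[of c d]) (auto intro: less_imp_le)
qed

text \<open>Inner regularity reduces the count to compact subsets of the box, and each of these fits
  into a rational subbox. The endpoints a and b now enter only through the inequalities that select
  terms of a countable supremum. This gives joint measurability in the configuration and the
  endpoints, as required for the boxes that move with t under Fubini.\<close>

lemma emeasure_box_SUP_rational:
  fixes \<xi> :: "('d::finite, 'm::{finite,discrete_topology}) site measure"
  assumes \<xi>: "\<xi> \<in> point_measures"
  shows "emeasure \<xi> (box a b \<times> {i}) = (SUP (c, d) \<in> rational_vectors \<times> rational_vectors.
    if (\<forall>k. a $ k \<le> c $ k \<and> d $ k \<le> b $ k) then emeasure \<xi> (box c d \<times> {i}) else 0)" (is "_ = ?S")
proof (rule antisym)
  note s = sets_point_measure[OF \<xi>]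
  have bor: "box c d \<times> {i} \<in> sets borel" for c d :: "real ^ 'd"
    by (intro Times_colour_borel) simp
  have rad: "emeasure \<xi> (box a b \<times> {i}) =
      (SUP K\<in>{K. compact K \<and> K \<in> sets borel \<and> K \<subseteq> box a b \<times> {i}}. emeasure \<xi> K)"
    using \<xi> bor by (simp add: point_measures_def radon_measure_def)
  show "emeasure \<xi> (box a b \<times> {i}) \<le> ?S"
    unfolding rad
  proof (rule SUP_least)
    fix K assume "K \<in> {K. compact K \<and> K \<in> sets borel \<and> K \<subseteq> box a b \<times> {i}}"
    then have K: "compact K" "K \<subseteq> box a b \<times> {i}" by auto
    show "emeasure \<xi> K \<le> ?S"
    proof (cases "K = {}")
      case False
      have "compact (fst ` K)" using K(1) by (intro compact_continuous_image continuous_intros)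
      moreover have "fst ` K \<subseteq> box a b" "fst ` K \<noteq> {}" using K(2) False by auto
      ultimately obtain c d where cd: "c \<in> rational_vectors" "d \<in> rational_vectors" "fst ` K \<subseteq> box c d"
        "\<And>k. a $ k \<le> c $ k" "\<And>k. d $ k \<le> b $ k"
        using compact_in_rational_box by blast
      have "K \<subseteq> box c d \<times> {i}" using K(2) cd(3) by force
      then have "emeasure \<xi> K \<le> emeasure \<xi> (box c d \<times> {i})"
        using bor s by (intro emeasure_mono) auto
      also have "\<dots> \<le> ?S"
        using cd by (intro SUP_upper2[of "(c, d)"]) auto
      finally show ?thesis .
    qed simp
  qed
  show "?S \<le> emeasure \<xi> (box a b \<times> {i})"
  proof (rule SUP_least, clarify, split if_split, intro conjI impI)
    fix c d :: "real ^ 'd" assume "\<forall>k. a $ k \<le> c $ k \<and> d $ k \<le> b $ k"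
    then have "box c d \<subseteq> box a b"
      unfolding mem_box_cart subset_iff by (meson less_le_trans le_less_trans)
    then show "emeasure \<xi> (box c d \<times> {i}) \<le> emeasure \<xi> (box a b \<times> {i})"
      using bor s by (intro emeasure_mono) auto
  qed simp
qed

lemma borel_measurable_box_count:
  fixes i :: "'m::{finite,discrete_topology}" and a b :: "'a \<Rightarrow> real ^ 'd::finite"
  assumes X: "X \<in> measurable M vague_borel" and [measurable]: "a \<in> borel_measurable M" "b \<in> borel_measurable M"
  shows "(\<lambda>\<omega>. emeasure (X \<omega>) (box (a \<omega>) (b \<omega>) \<times> {i})) \<in> borel_measurable M"
proof -
  have [measurable]: "(\<lambda>\<omega>. emeasure (X \<omega>) (box c d \<times> {i})) \<in> borel_measurable M" for c d :: "real ^ 'd"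
    using measurable_compose[OF X borel_measurable_fixed_box_count] .
  have "(\<lambda>\<omega>. SUP (c, d) \<in> rational_vectors \<times> rational_vectors.
      if (\<forall>k. a \<omega> $ k \<le> c $ k \<and> d $ k \<le> b \<omega> $ k) then emeasure (X \<omega>) (box c d \<times> {i}) else 0) \<in> borel_measurable M"
    unfolding case_prod_beta
    by (intro borel_measurable_SUP countable_SIGMA countable_rational_vectors) measurable
  moreover have "X \<omega> \<in> point_measures" if "\<omega> \<in> space M" for \<omega>
    using measurable_space[OF X that] by (simp add: space_vague_borel)
  ultimately show ?thesis
    by (simp add: emeasure_box_SUP_rational cong: measurable_cong)
qed

lemma borel_measurable_weighted_box:
  fixes w :: "'m::{finite,discrete_topology} \<Rightarrow> real" and a b :: "'a \<Rightarrow> real ^ 'd::finite"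
  assumes X: "X \<in> measurable M vague_borel" and ab: "a \<in> borel_measurable M" "b \<in> borel_measurable M"
  shows "(\<lambda>\<omega>. weighted w (X \<omega>) (box (a \<omega>) (b \<omega>))) \<in> borel_measurable M"
proof -
  note [measurable] = borel_measurable_box_count[OF X ab]
  have "(\<lambda>\<omega>. \<Sum>i\<in>UNIV. w i * enn2real (emeasure (X \<omega>) (box (a \<omega>) (b \<omega>) \<times> {i}))) \<in> borel_measurable M"
    by measurable
  moreover have "X \<omega> \<in> point_measures" if "\<omega> \<in> space M" for \<omega>
    using measurable_space[OF X that] by (simp add: space_vague_borel)
  ultimately show ?thesis
    by (simp add: weighted_eq measure_def cong: measurable_cong)
qed

section \<open>Translations acting on configurations\<close>

lemma continuous_shift: "continuous_on UNIV (shift t :: ('d::finite, 'm::{finite,discrete_topology}) site \<Rightarrow> _)"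
  unfolding shift_def by (intro continuous_intros)

lemma shift_shift [simp]: "shift s (shift t p) = shift (s + t) p"
  by (simp add: shift_def add.assoc)

lemma shift_0 [simp]: "shift 0 p = p"
  by (simp add: shift_def)

lemma shift_image_iff: "p \<in> shift t ` A \<longleftrightarrow> shift (- t) p \<in> A"
  by (metis (no_types, opaque_lifting) add.right_inverse add.left_inverse image_iff shift_0 shift_shift)

lemma shift_measurable:
  "shift t \<in> measurable borel (borel :: ('d::finite, 'm::{finite,discrete_topology}) site measure)"
  by (rule borel_measurable_continuous_onI[OF continuous_shift])

lemma shift_image_borel:
  fixes A :: "('d::finite, 'm::{finite,discrete_topology}) site set"
  assumes "A \<in> sets borel"
  shows "shift t ` A \<in> sets borel"
proof -
  have "shift t ` A = shift (- t) -` A \<inter> space borel"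
    by (auto simp: shift_image_iff)
  then show ?thesis using measurable_sets[OF shift_measurable assms] by metis
qed

lemma compact_shift_image:
  fixes A :: "('d::finite, 'm::{finite,discrete_topology}) site set"
  shows "compact A \<Longrightarrow> compact (shift t ` A)"
  by (rule compact_continuous_image[OF continuous_on_subset[OF continuous_shift subset_UNIV]])

lemma translate_point_measures:
  fixes \<xi> :: "('d::finite, 'm::{finite,discrete_topology}) site measure"
  assumes \<xi>: "\<xi> \<in> point_measures"
  shows "translate t \<xi> \<in> point_measures"
proof -
  note s = sets_point_measure[OF \<xi>]
  have e: "emeasure (translate t \<xi>) A = emeasure \<xi> (shift (- t) ` A)" if "A \<in> sets borel" for A
    using emeasure_translate[OF s that] .
  have st: "sets (translate t \<xi>) = sets borel" by (simp add: translate_def)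
  have img: "shift t ` shift (- t) ` A = A" "shift (- t) ` shift t ` A = A" for A :: "('d, 'm) site set"
    by (simp_all add: image_image)
  show ?thesis
    unfolding point_measures_def radon_measure_def
  proof (intro CollectI conjI allI ballI impI)
    show "sets (translate t \<xi>) = sets borel" by fact
    show "emeasure (translate t \<xi>) K < \<infinity>" if "compact K" for K
      using e[OF borel_compact[OF that]] finite_compact_point_measure[OF \<xi> compact_shift_image[OF that]] by simp
    show "emeasure (translate t \<xi>) A \<in> \<nat>" if A: "A \<in> sets borel" "compact (closure A)" for A
      unfolding e[OF A(1)] using A closure_subset
      by (intro nat_point_measure[OF \<xi> shift_image_borel _ compact_shift_image[OF A(2)]]) auto
    fix A :: "('d, 'm) site set" assume A: "A \<in> sets borel"
    let ?C = "\<lambda>A. {K. compact K \<and> K \<in> sets borel \<and> K \<subseteq> A}"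
    \<comment> \<open>Shifts permute the compact sets, so the approximating family of the shifted
      set is the shifted family; this carries inner regularity over.\<close>
    have "?C (shift (- t) ` A) = (`) (shift (- t)) ` ?C A"
    proof (intro equalityI subsetI)
      fix K assume "K \<in> ?C (shift (- t) ` A)"
      then have K: "compact K" "K \<in> sets borel" "K \<subseteq> shift (- t) ` A" by auto
      have "shift t ` K \<subseteq> A" using image_mono[OF K(3), of "shift t"] by (simp only: img)
      then have "shift t ` K \<in> ?C A"
        using compact_shift_image[OF K(1)] shift_image_borel[OF K(2)] by blast
      then show "K \<in> (`) (shift (- t)) ` ?C A"
        by (rule rev_image_eqI) (simp only: img)
    qed (auto intro: compact_shift_image shift_image_borel)
    then have "(SUP K\<in>?C (shift (- t) ` A). emeasure \<xi> K) = (SUP K\<in>?C A. emeasure \<xi> (shift (- t) ` K))"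
      by (simp add: image_image)
    also have "\<dots> = (SUP K\<in>?C A. emeasure (translate t \<xi>) K)"
      by (intro SUP_cong) (auto simp: e)
    moreover have "emeasure \<xi> (shift (- t) ` A) = (SUP K\<in>?C (shift (- t) ` A). emeasure \<xi> K)"
      using \<xi> shift_image_borel[OF A] by (simp add: point_measures_def radon_measure_def)
    ultimately show "emeasure (translate t \<xi>) A = (SUP K\<in>?C A. emeasure (translate t \<xi>) K)"
      using e[OF A] by simp
  qed
qed

lemma integral_translate:
  fixes \<xi> :: "('d::finite, 'm::{finite,discrete_topology}) site measure" and f :: "_ \<Rightarrow> real"
  assumes \<xi>: "\<xi> \<in> point_measures" and f: "f \<in> borel_measurable borel"
  shows "(\<integral>p. f p \<partial>translate t \<xi>) = (\<integral>p. f (shift t p) \<partial>\<xi>)"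
  unfolding translate_def
  using shift_measurable[of t] f sets_point_measure[OF \<xi>]
  by (intro integral_distr) (simp_all cong: measurable_cong_sets)

lemma Cc_shift:
  fixes f :: "('d::finite, 'm::{finite,discrete_topology}) site \<Rightarrow> real"
  assumes "f \<in> Cc euclidean"
  shows "(\<lambda>p. f (shift t p)) \<in> Cc euclidean"
proof (rule Cc_euclideanI)
  show "continuous_on UNIV (\<lambda>p. f (shift t p))"
    by (rule continuous_on_compose2[OF Cc_euclideanD(1)[OF assms] continuous_shift]) auto
  show "compact (shift (- t) ` closure {x. f x \<noteq> 0})"
    by (rule compact_shift_image[OF Cc_euclideanD(2)[OF assms]])
  fix x assume "x \<notin> shift (- t) ` closure {x. f x \<noteq> 0}"
  then have "shift t x \<notin> {x. f x \<noteq> 0}"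
    using closure_subset[of "{x. f x \<noteq> 0}"] by (auto simp: shift_image_iff)
  then show "f (shift t x) = 0" by simp
qed

text \<open>It is enough to test continuity on the generating sets, where translating the
  configuration amounts to replacing the test function by its composition with
  \<open>shift t\<close>, again continuous of compact support.\<close>

lemma measurable_translate:
  "translate t \<in> measurable vague_borel (vague_borel :: ('d::finite, 'm::{finite,discrete_topology}) site measure measure)"
proof -
  have "continuous_map (vague :: ('d, 'm) site measure topology) vague (translate t)"
    unfolding continuous_map_def topspace_vague
  proof (intro conjI allI impI)
    show "translate t \<in> point_measures \<rightarrow> point_measures"
      using translate_point_measures by blast
    fix U :: "('d, 'm) site measure set" assume "openin vague U"
    then have "generate_topology_on {{\<xi> \<in> point_measures. (\<integral>p. f p \<partial>\<xi>) \<in> U} | f U. f \<in> Cc euclidean \<and> open U} U"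
      by (simp add: vague_def openin_topology_generated_by_iff)
    then show "openin vague {\<xi> \<in> point_measures. translate t \<xi> \<in> U}"
    proof (induction rule: generate_topology_on.induct)
      case Empty
      then show ?case by simp
    next
      case (Int A B)
      have "{\<xi> \<in> point_measures. translate t \<xi> \<in> A \<inter> B} =
        {\<xi> \<in> point_measures. translate t \<xi> \<in> A} \<inter> {\<xi> \<in> point_measures. translate t \<xi> \<in> B}" by blast
      then show ?case using Int by (simp only: openin_Int)
    next
      case (UN K)
      have "{\<xi> \<in> point_measures. translate t \<xi> \<in> \<Union> K} = (\<Union>A\<in>K. {\<xi> \<in> point_measures. translate t \<xi> \<in> A})" by blast
      then show ?case using UN by auto
    next
      case (Basis S)
      then obtain f U where S: "S = {\<xi> \<in> point_measures. (\<integral>p. f p \<partial>\<xi>) \<in> U}" and f: "f \<in> Cc euclidean" and U: "open U"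
        by blast
      have "(\<integral>p. f p \<partial>translate t \<xi>) = (\<integral>p. f (shift t p) \<partial>\<xi>)" if "\<xi> \<in> point_measures" for \<xi>
        using integral_translate[OF that] borel_measurable_continuous_onI[OF Cc_euclideanD(1)[OF f]] by blast
      then have "{\<xi> \<in> point_measures. translate t \<xi> \<in> S} = {\<xi> \<in> point_measures. (\<integral>p. f (shift t p) \<partial>\<xi>) \<in> U}"
        using translate_point_measures by (auto simp: S)
      then show ?case using openin_vague_integral[OF Cc_shift[OF f] U] by simp
    qed
  qed
  then have *: "openin vague {\<xi> \<in> point_measures. translate t \<xi> \<in> U}" if "openin vague U" for U :: "('d, 'm) site measure set"
    using that by (simp add: continuous_map_def topspace_vague)
  show ?thesis
    unfolding vague_borel_def
  proof (rule measurable_measure_of)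
    show "translate t \<in> space (sigma point_measures {U. openin vague U}) \<rightarrow> point_measures"
      using translate_point_measures by (auto simp: space_measure_of_conv)
    show "{U. openin vague U} \<subseteq> Pow (point_measures :: ('d, 'm) site measure set)"
      using openin_subset topspace_vague by blast
    fix U :: "('d, 'm) site measure set" assume "U \<in> {U. openin vague U}"
    then have "{\<xi> \<in> point_measures. translate t \<xi> \<in> U} \<in> sets vague_borel"
      using * by (auto simp: sets_vague_borel)
    then show "translate t -` U \<inter> space (sigma point_measures {U. openin vague U}) \<in> sets (sigma point_measures {U. openin vague U})"
      by (simp add: space_measure_of_conv vague_borel_def vimage_def Int_def conj_commute)
  qed
qed

lemma weighted_translate_box:
  fixes \<xi> :: "('d::finite, 'm::{finite,discrete_topology}) site measure"
  assumes \<xi>: "\<xi> \<in> point_measures"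
  shows "weighted w (translate t \<xi>) (box a b) = weighted w \<xi> (box (a - t) (b - t))"
proof -
  have "shift (- t) ` (box a b \<times> {i}) = box (a - t) (b - t) \<times> {i}" for i :: 'm
    by (auto simp: shift_image_iff mem_box_cart) (auto simp: shift_def mem_box_cart algebra_simps)
  then have "measure (translate t \<xi>) (box a b \<times> {i}) = measure \<xi> (box (a - t) (b - t) \<times> {i})" for i :: 'm
    using emeasure_translate[OF sets_point_measure[OF \<xi>] Times_colour_borel[of "box a b" i], of t]
    by (simp add: measure_def)
  then show ?thesis
    using \<xi> by (simp add: weighted_eq translate_point_measures)
qed

section \<open>Correlation averages of box overlaps\<close>

text \<open>This is the volume of B_0 \<inter> (B_1 - z_1) \<inter> ... \<inter> (B_n - z_n) in
  coordinates: an intersection of boxes is the box between the largest lower and the smallest upper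
  endpoints, and \<open>max 0\<close> accounts for an empty intersection. In this form continuity in
  z is evident. Tuples live on \<open>{1..n}\<close>, so index 0 receives the displacement 0 instead
  of \<open>z 0\<close>.\<close>

definition box_overlap ::
    "nat \<Rightarrow> (nat \<Rightarrow> real ^ 'd::finite) \<Rightarrow> (nat \<Rightarrow> real ^ 'd) \<Rightarrow> (nat \<Rightarrow> real ^ 'd) \<Rightarrow> real" where
  "box_overlap n a b z = (\<Prod>k\<in>UNIV. max 0
     (Min ((\<lambda>j. b j $ k - (if j = 0 then 0 else z j $ k)) ` {0..n}) -
      Max ((\<lambda>j. a j $ k - (if j = 0 then 0 else z j $ k)) ` {0..n})))"

lemma measure_lborel_box_cart:
  fixes l u :: "real ^ 'd::finite"
  shows "measure lborel (box l u) = (\<Prod>k\<in>UNIV. max 0 (u $ k - l $ k))"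
proof -
  have *: "measure lborel (box l u) = measure lborel (cbox l u)"
    by (simp add: measure_lborel_box_eq measure_lborel_cbox_eq)
  show ?thesis
  proof (cases "\<forall>k. l $ k \<le> u $ k")
    case True
    then have "measure lborel (cbox l u) = (\<Prod>k\<in>UNIV. u $ k - l $ k)"
      by (intro content_cbox_cart) (simp add: interval_ne_empty_cart)
    also have "\<dots> = (\<Prod>k\<in>UNIV. max 0 (u $ k - l $ k))"
      using True by (intro prod.cong) (auto simp: max_def)
    finally show ?thesis using * by simp
  next
    case False
    then obtain k where k: "u $ k < l $ k" by (auto simp: not_le)
    then have "cbox l u = {}" by (auto simp: interval_eq_empty_cart)
    moreover have "(\<Prod>k\<in>UNIV. max 0 (u $ k - l $ k)) = 0"
      using k by (intro prod_zero bexI[of _ k]) auto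
    ultimately show ?thesis using * by simp
  qed
qed

lemma prod_indicator_eq:
  assumes "finite I"
  shows "(\<Prod>j\<in>I. indicator (A j) (x j) :: real) = (if \<forall>j\<in>I. x j \<in> A j then 1 else 0)"
  using assms by (induction I rule: finite_induct) auto

lemma box_overlap_eq_integral:
  "box_overlap n a b z =
    (\<integral>s. indicator (box (a 0) (b 0)) s * (\<Prod>j=1..n. indicator (box (a j) (b j)) (s + z j)) \<partial>lborel)"
proof -
  define y where "y j = (if j = 0 then 0 else z j)" for j
  define lo where "lo = (\<chi> k. Max ((\<lambda>j. a j $ k - (if j = 0 then 0 else z j $ k)) ` {0..n}))"
  define hi where "hi = (\<chi> k. Min ((\<lambda>j. b j $ k - (if j = 0 then 0 else z j $ k)) ` {0..n}))"
  have "indicator (box (a 0) (b 0)) s * (\<Prod>j=1..n. indicator (box (a j) (b j)) (s + z j)) = (indicator (box lo hi) s :: real)" for s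
  proof -
    have "indicator (box (a 0) (b 0)) s * (\<Prod>j=1..n. indicator (box (a j) (b j)) (s + z j) :: real)
      = (if s \<in> box (a 0) (b 0) \<and> (\<forall>j\<in>{1..n}. s + z j \<in> box (a j) (b j)) then 1 else 0)"
      by (simp add: prod_indicator_eq)
    also have "s \<in> box (a 0) (b 0) \<and> (\<forall>j\<in>{1..n}. s + z j \<in> box (a j) (b j)) \<longleftrightarrow> (\<forall>j\<in>{0..n}. s + y j \<in> box (a j) (b j))"
    proof -
      have "{0..n} = insert 0 {1..n}" by auto
      then show ?thesis by (auto simp: y_def)
    qed
    also have "\<dots> \<longleftrightarrow> s \<in> box lo hi"
      unfolding mem_box_cart lo_def hi_def y_def vec_lambda_beta
      by (subst Max_less_iff, simp, simp, subst Min_gr_iff, simp, simp) (auto simp: less_diff_eq diff_less_eq)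
    finally show ?thesis by (simp add: indicator_def)
  qed
  then have "(\<integral>s. indicator (box (a 0) (b 0)) s * (\<Prod>j=1..n. indicator (box (a j) (b j)) (s + z j)) \<partial>lborel) = measure lborel (box lo hi)"
    by simp
  also have "\<dots> = box_overlap n a b z"
    by (simp add: measure_lborel_box_cart box_overlap_def lo_def hi_def)
  finally show ?thesis by simp
qed

lemma box_overlap_nonzeroE:
  assumes "box_overlap n a b z \<noteq> 0"
  obtains s where "s \<in> box (a 0) (b 0)" "\<And>j. j \<in> {1..n} \<Longrightarrow> s + z j \<in> box (a j) (b j)"
proof -
  have "\<exists>s. indicator (box (a 0) (b 0)) s * (\<Prod>j=1..n. indicator (box (a j) (b j)) (s + z j)) \<noteq> (0::real)"
  proof (rule ccontr)
    assume "\<not> ?thesis"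
    then have "indicator (box (a 0) (b 0)) s * (\<Prod>j=1..n. indicator (box (a j) (b j)) (s + z j)) = (0::real)" for s
      by blast
    then show False using assms unfolding box_overlap_eq_integral by (simp only: integral_zero)
  qed
  then obtain s where "s \<in> box (a 0) (b 0)" "(\<Prod>j=1..n. indicator (box (a j) (b j)) (s + z j)) \<noteq> (0::real)"
    by (auto simp: indicator_def split: if_splits)
  then show thesis
    using that[of s] by (auto simp: prod_indicator_eq simp del: prod_eq_1_iff split: if_splits)
qed

lemma continuous_map_Max:
  fixes h :: "'b \<Rightarrow> 'a \<Rightarrow> real"
  assumes "finite J" "J \<noteq> {}" "\<And>j. j \<in> J \<Longrightarrow> continuous_map T euclideanreal (h j)"
  shows "continuous_map T euclideanreal (\<lambda>x. Max ((\<lambda>j. h j x) ` J))"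
  using assms
proof (induction J rule: finite_ne_induct)
  case (insert j J)
  then show ?case by (simp add: continuous_map_real_max)
qed simp

lemma continuous_map_Min:
  fixes h :: "'b \<Rightarrow> 'a \<Rightarrow> real"
  assumes "finite J" "J \<noteq> {}" "\<And>j. j \<in> J \<Longrightarrow> continuous_map T euclideanreal (h j)"
  shows "continuous_map T euclideanreal (\<lambda>x. Min ((\<lambda>j. h j x) ` J))"
  using assms
proof (induction J rule: finite_ne_induct)
  case (insert j J)
  then show ?case by (simp add: continuous_map_real_min)
qed simp

text \<open>Maxima, minima and products preserve continuity. If the overlap is nonzero, some s lies
  in B_0 with s + z_j in B_j, so |z_j| is bounded by the sum of the radii of balls around 0
  containing the two boxes; a product of closed balls therefore contains the support.\<close>

lemma box_overlap_Cc:
  fixes a b :: "nat \<Rightarrow> real ^ 'd::finite"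
  shows "box_overlap n a b \<in> Cc (tuples n)"
  unfolding Cc_def
proof (intro CollectI conjI)
  have comp: "continuous_map (tuples n) euclideanreal (\<lambda>z. if j = 0 then 0 else z j $ k)" if "j \<in> {0..n}" for j and k :: 'd
  proof (cases "j = 0")
    case False
    then have "continuous_map (tuples n) euclidean (\<lambda>z. z j)"
      using that by (intro continuous_map_product_projection) auto
    moreover have "continuous_map euclidean euclideanreal (\<lambda>x :: real ^ 'd. x $ k)"
      by (simp add: continuous_map_iff_continuous2 continuous_intros)
    ultimately have "continuous_map (tuples n) euclideanreal ((\<lambda>x. x $ k) \<circ> (\<lambda>z. z j))"
      by (rule continuous_map_compose)
    then show ?thesis using False by (simp add: o_def)
  qed simp
  show "continuous_map (tuples n) euclideanreal (box_overlap n a b)"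
    unfolding box_overlap_def
    by (intro continuous_map_prod continuous_map_real_max continuous_map_diff continuous_map_Min
      continuous_map_Max comp) auto
  have "\<forall>j. \<exists>\<rho>. box (a j) (b j) \<subseteq> cball 0 \<rho>"
    using bounded_box unfolding bounded_iff subset_iff mem_cball_0 by blast
  then obtain \<rho> where \<rho>: "\<And>j. box (a j) (b j) \<subseteq> cball 0 (\<rho> j)" by metis
  let ?K = "PiE {1..n} (\<lambda>j. cball 0 (\<rho> j + \<rho> 0)) :: (nat \<Rightarrow> real ^ 'd) set"
  have K: "compactin (tuples n) ?K"
    by (simp add: compactin_PiE compactin_euclidean_iff)
  have "{z \<in> topspace (tuples n). box_overlap n a b z \<noteq> 0} \<subseteq> ?K"
  proof
    fix z assume z: "z \<in> {z \<in> topspace (tuples n). box_overlap n a b z \<noteq> 0}"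
    then obtain s where s: "s \<in> box (a 0) (b 0)" "\<And>j. j \<in> {1..n} \<Longrightarrow> s + z j \<in> box (a j) (b j)"
      using box_overlap_nonzeroE by blast
    have "norm (z j) \<le> \<rho> j + \<rho> 0" if "j \<in> {1..n}" for j
    proof -
      have "norm (s + z j) \<le> \<rho> j" "norm s \<le> \<rho> 0" using subsetD[OF \<rho> s(1)] subsetD[OF \<rho> s(2)[OF that]] by simp_all
      then show ?thesis using norm_triangle_ineq4[of "s + z j" s] by simp
    qed
    then show "z \<in> ?K" using z by (auto simp: PiE_iff topspace_product_topology)
  qed
  moreover have "closedin (tuples n) ?K"
    by (simp add: closedin_product_topology)
  ultimately show "compactin (tuples n) (tuples n closure_of {z \<in> topspace (tuples n). box_overlap n a b z \<noteq> 0})"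
    by (intro closed_compactin[OF K] closure_of_minimal closedin_closure_of)
qed

text \<open>Inside a compact set the weighted mass is a finite sum over positions, so that sums and
  integrals can be exchanged freely later on.\<close>

lemma weighted_finite_atoms:
  fixes \<xi> :: "('d::finite, 'm::{finite,discrete_topology}) site measure"
  assumes \<xi>: "\<xi> \<in> point_measures" and D: "compact D"
  obtains P where "finite P" "P \<subseteq> D"
    "\<And>A. \<lbrakk>A \<in> sets borel; A \<subseteq> D\<rbrakk> \<Longrightarrow> weighted w \<xi> A = (\<Sum>x\<in>P \<inter> A. weighted w \<xi> {x})"
proof -
  have cpt: "compact (D \<times> (UNIV :: 'm set))"
    using D by (simp add: compact_Times finite_imp_compact)
  obtain F0 where F0: "finite F0" "F0 \<subseteq> D \<times> UNIV" "emeasure \<xi> (D \<times> UNIV - F0) = 0"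
    using point_measure_finite_atoms[OF \<xi> cpt] .
  define P where "P = fst ` F0"
  define F where "F = P \<times> (UNIV :: 'm set)"
  have P: "finite P" "P \<subseteq> D" using F0 by (auto simp: P_def)
  have F: "finite F" "F \<subseteq> D \<times> UNIV" using P by (auto simp: F_def)
  have "F0 \<subseteq> F" by (force simp: F_def P_def)
  moreover have "D \<times> UNIV - F0 \<in> sets \<xi>"
    using F0(1) sets_point_measure[OF \<xi>] borel_compact[OF cpt] borel_closed[OF finite_imp_closed[OF F0(1)]] by auto
  ultimately have null: "emeasure \<xi> (D \<times> UNIV - F) = 0"
    using F0(3) by (metis Diff_mono emeasure_eq_0 order_refl)
  have "weighted w \<xi> A = (\<Sum>x\<in>P \<inter> A. weighted w \<xi> {x})" if A: "A \<in> sets borel" "A \<subseteq> D" for A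
  proof -
    have "measure \<xi> (A \<times> {i}) = (\<Sum>x\<in>P \<inter> A. measure \<xi> ({x} \<times> {i}))" for i
    proof -
      have "measure \<xi> (A \<times> {i}) = (\<Sum>p\<in>F \<inter> A \<times> {i}. measure \<xi> {p})"
        using A by (intro measure_point_measure_atoms[OF \<xi> cpt F null] Times_colour_borel) auto
      also have "F \<inter> A \<times> {i} = (\<lambda>x. (x, i)) ` (P \<inter> A)" by (auto simp: F_def)
      also have "(\<Sum>p\<in>\<dots>. measure \<xi> {p}) = (\<Sum>x\<in>P \<inter> A. measure \<xi> ({x} \<times> {i}))"
        by (subst sum.reindex) (auto simp: inj_on_def)
      finally show ?thesis .
    qed
    then show ?thesis
      using A(1) by (simp add: weighted_eq[OF \<xi>] sum_distrib_left) (rule sum.swap)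
  qed
  then show thesis using that P by blast
qed

text \<open>Once the overlap is written as an integral over t, the sum over tuples can be taken
  inside. For fixed t the summand is a product of one factor in x and one factor in each y_j, so the
  sum splits into weighted box masses. Only x is confined to the cube, hence only the box with index
  0 is cut.\<close>

lemma correlation_average_box_overlap:
  fixes \<xi> :: "('d::finite, 'm::{finite,discrete_topology}) site measure"
  assumes \<xi>: "\<xi> \<in> point_measures"
  shows "correlation_average w n \<xi> (box_overlap n a b) R =
    1 / measure lborel (cube R :: (real ^ 'd) set) *
    (\<integral>t. weighted w \<xi> (cube R \<inter> box (a 0 - t) (b 0 - t)) *
      (\<Prod>j=1..n. weighted w \<xi> (box (a j - t) (b j - t))) \<partial>lborel)"
proof -
  define c where "c x = weighted w \<xi> {x}" for x
  let ?B = "\<lambda>j. box (a j) (b j)"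
  have "bounded (cube R \<union> (\<Union>j\<in>{0..n}. ?B j))"
    by (auto simp: cube_eq_box)
  then have "\<exists>\<rho>. cube R \<union> (\<Union>j\<in>{0..n}. ?B j) \<subseteq> cball 0 \<rho>"
    unfolding bounded_iff subset_iff mem_cball_0 by blast
  then obtain \<rho> where \<rho>: "cube R \<union> (\<Union>j\<in>{0..n}. ?B j) \<subseteq> cball 0 \<rho>" ..
  have \<rho>C: "norm x \<le> \<rho>" if "x \<in> cube R" for x :: "real ^ 'd"
    using subsetD[OF \<rho>, of x] that by auto
  have \<rho>B: "norm x \<le> \<rho>" if "x \<in> ?B j" "j \<in> {0..n}" for x j
  proof -
    have "x \<in> cube R \<union> (\<Union>j\<in>{0..n}. ?B j)" using that by blast
    then show ?thesis using subsetD[OF \<rho>] by (metis mem_cball_0)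
  qed
  \<comment> \<open>The radius is 3\<rho> because x and x + t of norm at most \<rho> force t to have
    norm at most 2\<rho>, and then y + t in some B_j forces y to have norm at most 3\<rho>. All
    relevant atoms thus lie in D.\<close>
  define D where "D = cball (0 :: real ^ 'd) (3 * \<rho>)"
  obtain P where P: "finite P" "P \<subseteq> D"
    and PA: "\<And>A. \<lbrakk>A \<in> sets borel; A \<subseteq> D\<rbrakk> \<Longrightarrow> weighted w \<xi> A = (\<Sum>x\<in>P \<inter> A. c x)"
    unfolding c_def using weighted_finite_atoms[OF \<xi>, of D w] by (auto simp: D_def)
  have c0: "c x = 0" if "x \<in> D" "x \<notin> P" for x
    using PA[of "{x}"] that by (simp add: c_def)
  have CD: "cube R \<subseteq> D"
  proof
    fix x :: "real ^ 'd" assume "x \<in> cube R"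
    from \<rho>C[OF this] show "x \<in> D" using norm_ge_zero[of x] unfolding D_def mem_cball_0 by linarith
  qed
  have near: "norm t \<le> 2 * \<rho>" if "x \<in> cube R" "x + t \<in> ?B 0" for x t
    using \<rho>C[OF that(1)] \<rho>B[OF that(2)] norm_triangle_ineq4[of "x + t" x] by simp
  have inD: "y \<in> D" if "norm t \<le> 2 * \<rho>" "y + t \<in> ?B j" "j \<in> {0..n}" for t y j
    using that(1) \<rho>B[OF that(2,3)] norm_triangle_ineq4[of "y + t" t] by (simp add: D_def)
  let ?\<phi> = "\<lambda>(x, y) t. indicator (?B 0) (x + t) * (\<Prod>j=1..n. indicator (?B j) (y j + t)) :: real"
  let ?Y = "{1..n} \<rightarrow>\<^sub>E P"
  have overlap: "box_overlap n a b (\<lambda>j\<in>{1..n}. y j - x) = (\<integral>t. ?\<phi> (x, y) t \<partial>lborel)" for x y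
  proof -
    \<comment> \<open>The substitution s = x + t, by translation invariance of Lebesgue measure,
      turns s + (y_j - x) into y_j + t.\<close>
    have "box_overlap n a b (\<lambda>j\<in>{1..n}. y j - x) =
        (\<integral>s. indicator (?B 0) s * (\<Prod>j=1..n. indicator (?B j) (s + (y j - x))) \<partial>distr lborel borel ((+) x))"
      unfolding box_overlap_eq_integral lborel_distr_plus by (intro Bochner_Integration.integral_cong refl arg_cong2[where f = "(*)"] prod.cong) auto
    also have "\<dots> = (\<integral>t. indicator (?B 0) (x + t) * (\<Prod>j=1..n. indicator (?B j) ((x + t) + (y j - x))) \<partial>lborel)"
      by (subst integral_distr) (auto simp: box_def intro!: borel_measurable_times borel_measurable_prod)
    also have "\<dots> = (\<integral>t. ?\<phi> (x, y) t \<partial>lborel)"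
      by (simp add: algebra_simps)
    finally show ?thesis .
  qed
  have int: "integrable lborel (?\<phi> (x, y))" for x y
  proof (rule Bochner_Integration.integrable_bound)
    show "integrable lborel (indicator (box (a 0 - x) (b 0 - x)) :: _ \<Rightarrow> real)"
      by (intro integrable_real_indicator emeasure_bounded_finite bounded_box) simp
    show "?\<phi> (x, y) \<in> borel_measurable lborel"
      unfolding prod.case by (intro borel_measurable_times borel_measurable_prod)
        (auto intro!: measurable_compose[OF _ borel_measurable_indicator])
    show "AE t in lborel. norm (?\<phi> (x, y) t) \<le> norm (indicator (box (a 0 - x) (b 0 - x)) t :: real)"
      unfolding prod.case prod_indicator_eq[OF finite_atLeastAtMost]
      by (intro AE_I2) (auto simp: indicator_def mem_box_cart algebra_simps)
  qed
  have "(\<Sum>\<^sub>\<infinity>(x, y) \<in> cube R \<times> ({1..n} \<rightarrow>\<^sub>E UNIV).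
        c x * (\<Prod>i=1..n. c (y i)) * box_overlap n a b (\<lambda>i\<in>{1..n}. y i - x)) =
      (\<Sum>\<^sub>\<infinity>(x, y) \<in> (P \<inter> cube R) \<times> ?Y. c x * (\<Prod>i=1..n. c (y i)) * box_overlap n a b (\<lambda>i\<in>{1..n}. y i - x))"
  proof (rule infsum_cong_neutral)
    fix p assume p: "p \<in> cube R \<times> ({1..n} \<rightarrow>\<^sub>E UNIV) - (P \<inter> cube R) \<times> ?Y"
    obtain x y where xy: "p = (x, y)" "x \<in> cube R" "y \<in> {1..n} \<rightarrow>\<^sub>E UNIV" using p by auto
    show "(case p of (x, y) \<Rightarrow> c x * (\<Prod>i=1..n. c (y i)) * box_overlap n a b (\<lambda>i\<in>{1..n}. y i - x)) = 0"
    proof (rule ccontr)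
      assume "\<not> ?thesis"
      then have ne: "c x \<noteq> 0" "\<And>i. i \<in> {1..n} \<Longrightarrow> c (y i) \<noteq> 0" "box_overlap n a b (\<lambda>i\<in>{1..n}. y i - x) \<noteq> 0"
        by (auto simp: xy(1))
      obtain s where s: "s \<in> ?B 0" "\<And>j. j \<in> {1..n} \<Longrightarrow> s + (\<lambda>i\<in>{1..n}. y i - x) j \<in> ?B j"
        using box_overlap_nonzeroE[OF ne(3)] by blast
      have t: "norm (s - x) \<le> 2 * \<rho>" using s(1) xy(2) by (intro near[of x]) auto
      have "y j \<in> P" if "j \<in> {1..n}" for j
      proof -
        have "y j \<in> D" using s(2)[OF that] that by (intro inD[OF t, of _ j]) (auto simp: algebra_simps)
        then show ?thesis using c0 ne(2)[OF that] by blast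
      qed
      moreover have "x \<in> P" using c0 ne(1) CD xy(2) by blast
      ultimately show False using p xy by (auto simp: PiE_iff)
    qed
  next
    fix p assume "p \<in> (P \<inter> cube R) \<times> ?Y - cube R \<times> ({1..n} \<rightarrow>\<^sub>E UNIV)"
    then show "(case p of (x, y) \<Rightarrow> c x * (\<Prod>i=1..n. c (y i)) * box_overlap n a b (\<lambda>i\<in>{1..n}. y i - x)) = 0"
      by (auto simp: PiE_iff)
  qed simp
  also have "\<dots> = (\<Sum>(x, y) \<in> (P \<inter> cube R) \<times> ?Y. c x * (\<Prod>i=1..n. c (y i)) * box_overlap n a b (\<lambda>i\<in>{1..n}. y i - x))"
    using P(1) by (intro infsum_finite finite_cartesian_product finite_Int finite_PiE) auto
  also have "\<dots> = (\<Sum>p \<in> (P \<inter> cube R) \<times> ?Y. \<integral>t. (c (fst p) * (\<Prod>i=1..n. c (snd p i))) * ?\<phi> p t \<partial>lborel)"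
    by (intro sum.cong refl) (simp only: case_prod_beta overlap integral_mult_right_zero fst_conv snd_conv)
  also have "\<dots> = (\<integral>t. (\<Sum>p \<in> (P \<inter> cube R) \<times> ?Y. (c (fst p) * (\<Prod>i=1..n. c (snd p i))) * ?\<phi> p t) \<partial>lborel)"
    using int by (intro Bochner_Integration.integral_sum[symmetric] integrable_mult_right) auto
  also have "\<dots> = (\<integral>t. weighted w \<xi> (cube R \<inter> box (a 0 - t) (b 0 - t)) *
      (\<Prod>j=1..n. weighted w \<xi> (box (a j - t) (b j - t))) \<partial>lborel)"
  proof (rule Bochner_Integration.integral_cong[OF refl])
    fix t :: "real ^ 'd"
    have bt: "x + t \<in> ?B j \<longleftrightarrow> x \<in> box (a j - t) (b j - t)" for x j
      by (auto simp: mem_box_cart algebra_simps)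
    have "(\<Sum>p \<in> (P \<inter> cube R) \<times> ?Y. (c (fst p) * (\<Prod>i=1..n. c (snd p i))) * ?\<phi> p t) =
      (\<Sum>p \<in> (P \<inter> cube R) \<times> ?Y. (c (fst p) * indicator (?B 0) (fst p + t)) * (\<Prod>j=1..n. c (snd p j) * indicator (?B j) (snd p j + t)))"
      by (intro sum.cong refl) (auto simp: prod.distrib)
    also have "\<dots> = (\<Sum>x\<in>P \<inter> cube R. c x * indicator (?B 0) (x + t)) *
        (\<Sum>y\<in>?Y. \<Prod>j=1..n. c (y j) * indicator (?B j) (y j + t))"
      by (simp add: sum_product sum.cartesian_product case_prod_beta)
    also have "(\<Sum>y\<in>?Y. \<Prod>j=1..n. c (y j) * indicator (?B j) (y j + t)) =
        (\<Prod>j=1..n. \<Sum>y\<in>P. c y * indicator (?B j) (y + t))"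
      \<comment> \<open>Distributivity: a sum over all functions into P of a product is the product
        of the sums over P.\<close>
      using P(1) by (intro prod_sum_PiE[symmetric]) auto
    also have "(\<Sum>x\<in>P \<inter> cube R. c x * indicator (?B 0) (x + t)) = weighted w \<xi> (cube R \<inter> box (a 0 - t) (b 0 - t))"
    proof -
      have "(\<Sum>x\<in>P \<inter> cube R. c x * indicator (?B 0) (x + t)) = (\<Sum>x\<in>P \<inter> (cube R \<inter> box (a 0 - t) (b 0 - t)). c x)"
        using P(1) bt by (intro sum.mono_neutral_cong_right) (auto simp: indicator_def)
      also have "\<dots> = weighted w \<xi> (cube R \<inter> box (a 0 - t) (b 0 - t))"
        using CD by (intro PA[symmetric]) (auto simp: open_cube)
      finally show ?thesis .
    qed
    finally have eq: "(\<Sum>p \<in> (P \<inter> cube R) \<times> ?Y. (c (fst p) * (\<Prod>i=1..n. c (snd p i))) * ?\<phi> p t) =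
      weighted w \<xi> (cube R \<inter> box (a 0 - t) (b 0 - t)) * (\<Prod>j=1..n. \<Sum>y\<in>P. c y * indicator (?B j) (y + t))" .
    show "(\<Sum>p \<in> (P \<inter> cube R) \<times> ?Y. (c (fst p) * (\<Prod>i=1..n. c (snd p i))) * ?\<phi> p t) =
      weighted w \<xi> (cube R \<inter> box (a 0 - t) (b 0 - t)) * (\<Prod>j=1..n. weighted w \<xi> (box (a j - t) (b j - t)))"
    \<comment> \<open>For distant t the boxes B_j - t may leave D, and then P no longer accounts for
      their atoms. In that case the cut box with index 0 is empty and both sides vanish.\<close>
    proof (cases "cube R \<inter> box (a 0 - t) (b 0 - t) = {}")
      case True
      then show ?thesis unfolding eq by (simp add: weighted_def)
    next
      case False
      then have t: "norm t \<le> 2 * \<rho>" using near bt by blast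
      have "(\<Sum>y\<in>P. c y * indicator (?B j) (y + t)) = weighted w \<xi> (box (a j - t) (b j - t))" if "j \<in> {1..n}" for j
      proof -
        have "(\<Sum>y\<in>P. c y * indicator (?B j) (y + t)) = (\<Sum>x\<in>P \<inter> box (a j - t) (b j - t). c x)"
          using P(1) bt by (intro sum.mono_neutral_cong_right) (auto simp: indicator_def)
        also have "\<dots> = weighted w \<xi> (box (a j - t) (b j - t))"
          using inD[OF t, of _ j] bt that by (intro PA[symmetric]) auto
        finally show ?thesis .
      qed
      then show ?thesis unfolding eq by simp
    qed
  qed
  finally show ?thesis
    unfolding correlation_average_def c_def[symmetric] by simp
qed

section \<open>Expected products of box masses\<close>

lemma measure_cube: "0 \<le> R \<Longrightarrow> measure lborel (cube R :: (real ^ 'd::finite) set) = R ^ CARD('d)"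
  by (simp add: cube_eq_box measure_lborel_box_cart)

text \<open>The carrier \<Omega> is only required to be measurable, of full measure and uniformly
  discrete. It need not be the support, which permits two processes to share one carrier.\<close>

locale stationary_hard_core = prob_space \<mu>
  for \<mu> :: "('d::finite, 'm::{finite,discrete_topology}) site measure measure" +
  fixes r :: real and \<Omega> :: "('d, 'm) site measure set"
  assumes sets_eq: "sets \<mu> = sets vague_borel"
    and stationary: "stationary \<mu>"
    and \<Omega>_sets: "\<Omega> \<in> sets \<mu>"
    and \<Omega>_subset: "\<Omega> \<subseteq> unif_discrete r"
    and AE_\<Omega>: "AE \<xi> in \<mu>. \<xi> \<in> \<Omega>"
begin

lemma space_eq: "space \<mu> = point_measures"
  using sets_eq_imp_space_eq[OF sets_eq] by (simp add: space_vague_borel)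

lemma \<Omega>_point_measures: "\<xi> \<in> \<Omega> \<Longrightarrow> \<xi> \<in> point_measures"
  using \<Omega>_subset by (auto simp: unif_discrete_def)

lemma measurable_weighted_box_pair:
  assumes "a \<in> borel_measurable borel" "b \<in> borel_measurable borel"
  shows "(\<lambda>p. weighted w (fst p) (box (a (snd p)) (b (snd p)))) \<in> borel_measurable (\<mu> \<Otimes>\<^sub>M (lborel :: (real ^ 'd) measure))"
proof (rule borel_measurable_weighted_box)
  show "fst \<in> measurable (\<mu> \<Otimes>\<^sub>M (lborel :: (real ^ 'd) measure)) vague_borel"
    using measurable_fst measurable_cong_sets[OF refl sets_eq] by blast
qed (use assms in measurable)

lemma measurable_weighted_box: "(\<lambda>\<xi>. weighted w \<xi> (box a b)) \<in> borel_measurable \<mu>"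
  using borel_measurable_weighted_box[of "\<lambda>\<xi>. \<xi>" \<mu> "\<lambda>_. a" "\<lambda>_. b" w]
  by (simp add: measurable_ident_sets[OF sets_eq])

lemma abs_weighted_box_le:
  assumes "\<xi> \<in> \<Omega>" "\<And>k. b $ k - a $ k \<le> r"
  shows "\<bar>weighted w \<xi> (box a b)\<bar> \<le> (\<Sum>i\<in>UNIV. \<bar>w i\<bar>)"
  using assms \<Omega>_subset by (intro abs_weighted_small_box_le[of _ r]) auto

context
  fixes w :: "'m \<Rightarrow> real" and n :: nat and a b :: "nat \<Rightarrow> real ^ 'd" and R :: real
  assumes small: "\<And>j k. j \<le> n \<Longrightarrow> b j $ k - a j $ k \<le> r"
    and R: "R > 0"
begin

text \<open>\<open>box (lo t) (hi t)\<close> is the intersection of \<open>box (a 0) (b 0)\<close> with \<open>t + cube R\<close>.\<close>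

definition lo :: "real ^ 'd \<Rightarrow> real ^ 'd" where "lo t = (\<chi> k. max (a 0 $ k) (t $ k - R / 2))"
definition hi :: "real ^ 'd \<Rightarrow> real ^ 'd" where "hi t = (\<chi> k. min (b 0 $ k) (t $ k + R / 2))"
text \<open>Outside this box the cube t + \<open>cube R\<close> misses B_0, so both integrands below
  are supported in it.\<close>

definition window :: "(real ^ 'd) set" where
  "window = box (\<chi> k. a 0 $ k - R / 2) (\<chi> k. b 0 $ k + R / 2)"
text \<open>\<open>moved\<close> is the integrand of the correlation average: the cube stands still
  and the boxes are translated by -t. In \<open>fixed\<close> the boxes stand still and the cube
  moves. The two differ by a translation of the configuration, so stationarity can be applied for
  each t separately.\<close>

definition moved :: "('d, 'm) site measure \<Rightarrow> real ^ 'd \<Rightarrow> real" where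
  "moved \<xi> t = weighted w \<xi> (box (lo t - t) (hi t - t)) * (\<Prod>j=1..n. weighted w \<xi> (box (a j - t) (b j - t)))"
definition fixed :: "('d, 'm) site measure \<Rightarrow> real ^ 'd \<Rightarrow> real" where
  "fixed \<xi> t = weighted w \<xi> (box (lo t) (hi t)) * (\<Prod>j=1..n. weighted w \<xi> (box (a j) (b j)))"

lemma measurable_lo_hi: "lo \<in> borel_measurable borel" "hi \<in> borel_measurable borel"
  unfolding lo_def[abs_def] hi_def[abs_def]
  by (intro borel_measurable_continuous_onI continuous_intros)+

lemma moved_eq_translate: "\<xi> \<in> point_measures \<Longrightarrow> moved \<xi> t = fixed (translate t \<xi>) t"
  by (simp add: moved_def fixed_def weighted_translate_box)

lemma correlation_average_eq_moved:
  "\<xi> \<in> point_measures \<Longrightarrow> correlation_average w n \<xi> (box_overlap n a b) R =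
    1 / measure lborel (cube R :: (real ^ 'd) set) * (\<integral>t. moved \<xi> t \<partial>lborel)"
proof -
  have "cube R \<inter> box (a 0 - t) (b 0 - t) = box (lo t - t) (hi t - t)" for t
  proof -
    have "(- (R / 2) < x $ k \<and> x $ k < R / 2) \<and> (a 0 - t) $ k < x $ k \<and> x $ k < (b 0 - t) $ k \<longleftrightarrow>
        (lo t - t) $ k < x $ k \<and> x $ k < (hi t - t) $ k" for x k
      by (simp add: lo_def hi_def) linarith
    then show ?thesis
      unfolding set_eq_iff Int_iff cube_def mem_Collect_eq mem_box_cart by blast
  qed
  then show "\<xi> \<in> point_measures \<Longrightarrow> ?thesis"
    by (simp add: correlation_average_box_overlap moved_def)
qed

lemma lo_hi_empty: "t \<notin> window \<Longrightarrow> box (lo t) (hi t) = {}" "t \<notin> window \<Longrightarrow> box (lo t - t) (hi t - t) = {}"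
proof -
  assume "t \<notin> window"
  then obtain k where k: "t $ k \<le> a 0 $ k - R / 2 \<or> t $ k \<ge> b 0 $ k + R / 2"
    by (auto simp: window_def mem_box_cart not_less)
  then have "hi t $ k \<le> lo t $ k"
    by (auto simp: lo_def hi_def max_def min_def)
  then show "box (lo t) (hi t) = {}" "box (lo t - t) (hi t - t) = {}"
    by (auto simp: interval_eq_empty_cart intro!: exI[of _ k])
qed

lemma lo_hi_small: "hi t $ k - lo t $ k \<le> r"
  using small[of 0 k] by (auto simp: lo_def hi_def max_def min_def)

text \<open>There are n + 1 factors, each a weighted mass of a small box and hence at most the sum
  of the |w i|.\<close>

definition bound :: real where "bound = (\<Sum>i\<in>UNIV. \<bar>w i\<bar>) ^ Suc n"

lemma prod_bound:
  assumes "x = 0 \<or> \<bar>x\<bar> \<le> (\<Sum>i\<in>UNIV. \<bar>w i\<bar>)" "\<And>j. j \<in> {1..n} \<Longrightarrow> \<bar>y j\<bar> \<le> (\<Sum>i\<in>UNIV. \<bar>w i\<bar>)"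
  shows "\<bar>x * (\<Prod>j=1..n. y j)\<bar> \<le> bound"
proof -
  have W: "0 \<le> (\<Sum>i\<in>UNIV. \<bar>w i\<bar>)" by (intro sum_nonneg) simp
  have "\<bar>\<Prod>j=1..n. y j\<bar> \<le> (\<Sum>i\<in>UNIV. \<bar>w i\<bar>) ^ n"
    using assms(2) unfolding abs_prod
    using prod_mono[of "{1..n}" "\<lambda>j. \<bar>y j\<bar>" "\<lambda>_. \<Sum>i\<in>UNIV. \<bar>w i\<bar>"] by simp
  moreover have "\<bar>x\<bar> \<le> (\<Sum>i\<in>UNIV. \<bar>w i\<bar>)" using assms(1) W by auto
  ultimately show ?thesis
    unfolding bound_def abs_mult power_Suc by (intro mult_mono W) auto
qed

lemma bound_nonneg: "0 \<le> bound"
  unfolding bound_def by (intro zero_le_power sum_nonneg) simp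

lemma abs_moved_le: "\<xi> \<in> \<Omega> \<Longrightarrow> \<bar>moved \<xi> t\<bar> \<le> bound * indicator window t"
proof (cases "t \<in> window")
  case True
  assume \<xi>: "\<xi> \<in> \<Omega>"
  have "\<bar>moved \<xi> t\<bar> \<le> bound"
    unfolding moved_def
    by (intro prod_bound disjI2 abs_weighted_box_le \<xi>) (use small lo_hi_small in auto)
  then show ?thesis using True by simp
qed (simp add: moved_def lo_hi_empty weighted_def)

lemma abs_fixed_le: "\<xi> \<in> \<Omega> \<Longrightarrow> \<bar>fixed \<xi> t\<bar> \<le> bound * indicator window t"
proof (cases "t \<in> window")
  case True
  assume \<xi>: "\<xi> \<in> \<Omega>"
  have "\<bar>fixed \<xi> t\<bar> \<le> bound"
    unfolding fixed_def
    by (intro prod_bound disjI2 abs_weighted_box_le \<xi>) (use small lo_hi_small in auto)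
  then show ?thesis using True by simp
qed (simp add: fixed_def lo_hi_empty weighted_def)

lemma integrable_window: "integrable lborel (\<lambda>t. bound * indicator window t)"
  unfolding window_def
  by (intro integrable_mult_right integrable_real_indicator emeasure_bounded_finite bounded_box) simp

text \<open>The window has edges of length at most R + r, and R + |r| \<le> R (|r| + 1) once R \<ge>
  1. After division by the volume of the cube the bound no longer depends on R, which makes it a
  dominating constant.\<close>

lemma abs_correlation_average_le:
  assumes "\<xi> \<in> \<Omega>" "R \<ge> 1"
  shows "\<bar>correlation_average w n \<xi> (box_overlap n a b) R\<bar> \<le> bound * (\<bar>r\<bar> + 1) ^ CARD('d)"
proof -
  have "\<bar>\<integral>t. moved \<xi> t \<partial>lborel\<bar> \<le> (\<integral>t. bound * indicator window t \<partial>lborel)"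
    using abs_moved_le[OF assms(1)] bound_nonneg
    by (intro order_trans[OF integral_abs_bound] integral_mono'[OF integrable_window]) auto
  also have "\<dots> = bound * measure lborel window"
    by simp
  also have "measure lborel window = (\<Prod>k\<in>UNIV. max 0 (b 0 $ k - a 0 $ k + R))"
    unfolding window_def measure_lborel_box_cart by (simp add: algebra_simps)
  also have "\<dots> \<le> (\<Prod>k\<in>(UNIV :: 'd set). R * (\<bar>r\<bar> + 1))"
  proof (rule prod_mono, intro conjI)
    fix k
    have "\<bar>r\<bar> \<le> R * \<bar>r\<bar>" using assms(2) mult_right_mono[of 1 R "\<bar>r\<bar>"] by simp
    then show "max 0 (b 0 $ k - a 0 $ k + R) \<le> R * (\<bar>r\<bar> + 1)"
      using small[of 0 k] R by (simp add: algebra_simps)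
  qed simp
  also have "\<dots> = R ^ CARD('d) * (\<bar>r\<bar> + 1) ^ CARD('d)"
    by (simp add: power_mult_distrib)
  finally have "\<bar>\<integral>t. moved \<xi> t \<partial>lborel\<bar> \<le> bound * (R ^ CARD('d) * (\<bar>r\<bar> + 1) ^ CARD('d))"
    using bound_nonneg by (auto simp: mult_left_mono)
  then show ?thesis
    using R by (simp add: correlation_average_eq_moved[OF \<Omega>_point_measures[OF assms(1)]] measure_cube
      abs_mult field_simps)
qed

lemma measurable_moved: "case_prod moved \<in> borel_measurable (\<mu> \<Otimes>\<^sub>M lborel)"
  unfolding moved_def case_prod_beta
  using measurable_lo_hi
  by (intro borel_measurable_times borel_measurable_prod
    measurable_weighted_box_pair[where a = "\<lambda>t. lo t - t" and b = "\<lambda>t. hi t - t"]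
    measurable_weighted_box_pair[where a = "\<lambda>t. _ - t" and b = "\<lambda>t. _ - t"]) auto

lemma measurable_fixed: "case_prod fixed \<in> borel_measurable (\<mu> \<Otimes>\<^sub>M lborel)"
  unfolding fixed_def case_prod_beta
  using measurable_lo_hi
  by (intro borel_measurable_times borel_measurable_prod
    measurable_weighted_box_pair[where a = lo and b = hi]
    measurable_weighted_box_pair[where a = "\<lambda>t. _" and b = "\<lambda>t. _"]) auto

lemma Fubini_bounded:
  assumes [measurable]: "case_prod f \<in> borel_measurable (\<mu> \<Otimes>\<^sub>M lborel)"
    and le: "\<And>\<xi> t. \<xi> \<in> \<Omega> \<Longrightarrow> \<bar>f \<xi> t\<bar> \<le> bound * indicator window t"
  shows "(\<integral>\<xi>. (\<integral>t. f \<xi> t \<partial>lborel) \<partial>\<mu>) = (\<integral>t. (\<integral>\<xi>. f \<xi> t \<partial>\<mu>) \<partial>lborel)"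
proof -
  interpret pair_sigma_finite \<mu> "lborel :: (real ^ 'd) measure" ..
  note [measurable] = \<Omega>_sets
  \<comment> \<open>The bound on f holds only on \<Omega>, while integrability on the product space
    calls for one on a set of full measure; cutting off with the indicator of \<Omega> makes it hold
    everywhere and changes the integrals over \<mu> not at all.\<close>
  define g where "g \<xi> t = indicator \<Omega> \<xi> * f \<xi> t" for \<xi> t
  have gm[measurable]: "case_prod g \<in> borel_measurable (\<mu> \<Otimes>\<^sub>M lborel)"
    unfolding g_def[abs_def] by measurable
  have int: "integrable (\<mu> \<Otimes>\<^sub>M lborel) (case_prod g)"
  proof (rule Bochner_Integration.integrable_bound)
    have W: "window \<in> sets lborel" by (simp add: window_def)
    have "emeasure lborel window < \<infinity>"
      unfolding window_def by (intro emeasure_bounded_finite bounded_box)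
    then have "emeasure (\<mu> \<Otimes>\<^sub>M lborel) (space \<mu> \<times> window) < \<infinity>"
      using W by (simp add: lborel.emeasure_pair_measure_Times emeasure_space_1)
    then show "integrable (\<mu> \<Otimes>\<^sub>M lborel) (\<lambda>p. bound * indicator (space \<mu> \<times> window) p)"
      using W by (intro integrable_mult_right integrable_real_indicator) auto
    show "AE p in \<mu> \<Otimes>\<^sub>M lborel. norm (case_prod g p) \<le> norm (bound * indicator (space \<mu> \<times> window) p)"
    proof (intro AE_I2)
      fix p assume "p \<in> space (\<mu> \<Otimes>\<^sub>M (lborel :: (real ^ 'd) measure))"
      then show "norm (case_prod g p) \<le> norm (bound * indicator (space \<mu> \<times> window) p)"
        using le[of "fst p" "snd p"] bound_nonneg
        by (cases p) (auto simp: g_def space_pair_measure abs_mult indicator_def split: if_splits)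
    qed
  qed fact
  have "(\<integral>\<xi>. (\<integral>t. f \<xi> t \<partial>lborel) \<partial>\<mu>) = (\<integral>\<xi>. (\<integral>t. g \<xi> t \<partial>lborel) \<partial>\<mu>)"
    by (rule integral_cong_AE) (use AE_\<Omega> in \<open>measurable, auto simp: g_def\<close>)
  also have "\<dots> = (\<integral>t. (\<integral>\<xi>. g \<xi> t \<partial>\<mu>) \<partial>lborel)"
    by (rule Fubini_integral[OF int, symmetric])
  also have "\<dots> = (\<integral>t. (\<integral>\<xi>. f \<xi> t \<partial>\<mu>) \<partial>lborel)"
    by (intro Bochner_Integration.integral_cong refl integral_cong_AE)
      (use AE_\<Omega> in \<open>measurable, auto simp: g_def\<close>)
  finally show ?thesis .
qed

text \<open>Every point of \<open>box (a 0) (b 0)\<close> lies in the moving cube \<open>t + cube R\<close> for a set of \<open>t\<close> of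
  the same volume as \<open>cube R\<close>.\<close>

lemma integral_fixed:
  assumes \<xi>: "\<xi> \<in> point_measures"
  shows "(\<integral>t. fixed \<xi> t \<partial>lborel) = R ^ CARD('d) * (\<Prod>j\<in>{0..n}. weighted w \<xi> (box (a j) (b j)))"
proof -
  obtain P where P: "finite P" "P \<subseteq> cbox (a 0) (b 0)"
    and PA: "\<And>A. \<lbrakk>A \<in> sets borel; A \<subseteq> cbox (a 0) (b 0)\<rbrakk> \<Longrightarrow>
      weighted w \<xi> A = (\<Sum>x\<in>P \<inter> A. weighted w \<xi> {x})"
    using weighted_finite_atoms[OF \<xi> compact_cbox[of "a 0" "b 0"], of w] by metis
  \<comment> \<open>\<open>C x\<close> is x + \<open>cube R\<close>. The cube is symmetric, so x
    lies in t + \<open>cube R\<close> exactly if t lies in \<open>C x\<close>.\<close>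
  define C where "C x = box (\<chi> k. x $ k - R / 2) (\<chi> k. x $ k + R / 2)" for x :: "real ^ 'd"
  have box_lo_hi: "x \<in> box (lo t) (hi t) \<longleftrightarrow> x \<in> box (a 0) (b 0) \<and> t \<in> C x" for x t
    by (auto simp: mem_box_cart lo_def hi_def C_def algebra_simps)
  have eq: "weighted w \<xi> (box (lo t) (hi t)) = (\<Sum>x\<in>P \<inter> box (a 0) (b 0). weighted w \<xi> {x} * indicator (C x) t)" for t
  proof -
    have "box (lo t) (hi t) \<subseteq> cbox (a 0) (b 0)"
      using box_lo_hi box_subset_cbox by blast
    then have "weighted w \<xi> (box (lo t) (hi t)) = (\<Sum>x\<in>P \<inter> box (lo t) (hi t). weighted w \<xi> {x})"
      by (intro PA) auto
    also have "\<dots> = (\<Sum>x\<in>P \<inter> box (a 0) (b 0). weighted w \<xi> {x} * indicator (C x) t)"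
      using P(1) box_lo_hi by (intro sum.mono_neutral_cong_left) (auto simp: indicator_def)
    finally show ?thesis .
  qed
  have "(\<integral>t. weighted w \<xi> (box (lo t) (hi t)) \<partial>lborel) =
      (\<Sum>x\<in>P \<inter> box (a 0) (b 0). \<integral>t. weighted w \<xi> {x} * indicator (C x) t \<partial>lborel)"
    unfolding eq C_def
    by (intro Bochner_Integration.integral_sum integrable_mult_right integrable_real_indicator
      emeasure_bounded_finite bounded_box) simp
  also have "\<dots> = (\<Sum>x\<in>P \<inter> box (a 0) (b 0). weighted w \<xi> {x} * R ^ CARD('d))"
    using R by (intro sum.cong refl) (simp add: C_def measure_lborel_box_cart)
  also have "\<dots> = R ^ CARD('d) * (\<Sum>x\<in>P \<inter> box (a 0) (b 0). weighted w \<xi> {x})"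
    by (simp add: sum_distrib_left mult.commute)
  also have "(\<Sum>x\<in>P \<inter> box (a 0) (b 0). weighted w \<xi> {x}) = weighted w \<xi> (box (a 0) (b 0))"
    by (intro PA[symmetric] box_subset_cbox) simp
  finally have *: "(\<integral>t. weighted w \<xi> (box (lo t) (hi t)) \<partial>lborel) = R ^ CARD('d) * weighted w \<xi> (box (a 0) (b 0))" .
  have "{0..n} = insert 0 {1..n}" by auto
  then show ?thesis
    by (simp add: fixed_def * del: One_nat_def)
qed

lemma expectation_correlation_average:
  "(\<integral>\<xi>. correlation_average w n \<xi> (box_overlap n a b) R \<partial>\<mu>) =
    (\<integral>\<xi>. (\<Prod>j\<in>{0..n}. weighted w \<xi> (box (a j) (b j))) \<partial>\<mu>)"
proof -
  \<comment> \<open>Here t is held fixed, both as the translation vector and as the position of the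
    cube; for each such t the integrand \<open>fixed\<close> is a function of the configuration
    alone.\<close>
  have stat: "(\<integral>\<xi>. moved \<xi> t \<partial>\<mu>) = (\<integral>\<xi>. fixed \<xi> t \<partial>\<mu>)" for t
  proof -
    have "(\<integral>\<xi>. fixed \<xi> t \<partial>\<mu>) = (\<integral>\<xi>. fixed \<xi> t \<partial>distr \<mu> \<mu> (translate t))"
      using stationary by (simp add: stationary_def)
    also have "\<dots> = (\<integral>\<xi>. fixed (translate t \<xi>) t \<partial>\<mu>)"
    proof (rule integral_distr)
      show "translate t \<in> measurable \<mu> \<mu>"
        using measurable_translate measurable_cong_sets[OF sets_eq sets_eq] by blast
      show "(\<lambda>\<xi>. fixed \<xi> t) \<in> borel_measurable \<mu>"
        unfolding fixed_def by (intro borel_measurable_times borel_measurable_prod measurable_weighted_box)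
    qed
    also have "\<dots> = (\<integral>\<xi>. moved \<xi> t \<partial>\<mu>)"
      by (intro Bochner_Integration.integral_cong refl) (simp add: space_eq moved_eq_translate)
    finally show ?thesis by simp
  qed
  have "(\<integral>\<xi>. correlation_average w n \<xi> (box_overlap n a b) R \<partial>\<mu>) =
      (\<integral>\<xi>. 1 / R ^ CARD('d) * (\<integral>t. moved \<xi> t \<partial>lborel) \<partial>\<mu>)"
    using R by (intro Bochner_Integration.integral_cong refl)
      (simp add: correlation_average_eq_moved space_eq measure_cube)
  also have "\<dots> = 1 / R ^ CARD('d) * (\<integral>t. (\<integral>\<xi>. moved \<xi> t \<partial>\<mu>) \<partial>lborel)"
    by (simp add: Fubini_bounded[OF measurable_moved abs_moved_le])
  also have "\<dots> = 1 / R ^ CARD('d) * (\<integral>\<xi>. (\<integral>t. fixed \<xi> t \<partial>lborel) \<partial>\<mu>)"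
    unfolding stat by (simp add: Fubini_bounded[OF measurable_fixed abs_fixed_le])
  also have "(\<integral>\<xi>. (\<integral>t. fixed \<xi> t \<partial>lborel) \<partial>\<mu>) =
      (\<integral>\<xi>. R ^ CARD('d) * (\<Prod>j\<in>{0..n}. weighted w \<xi> (box (a j) (b j))) \<partial>\<mu>)"
    by (intro Bochner_Integration.integral_cong refl integral_fixed) (simp add: space_eq)
  finally show ?thesis using R by simp
qed

lemma measurable_correlation_average:
  "(\<lambda>\<xi>. correlation_average w n \<xi> (box_overlap n a b) R) \<in> borel_measurable \<mu>"
proof -
  have "(\<lambda>\<xi>. \<integral>t. moved \<xi> t \<partial>lborel) \<in> borel_measurable \<mu>"
    using measurable_moved by (rule lborel.borel_measurable_lebesgue_integral)
  then have "(\<lambda>\<xi>. 1 / measure lborel (cube R :: (real ^ 'd) set) * (\<integral>t. moved \<xi> t \<partial>lborel)) \<in> borel_measurable \<mu>"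
    by measurable
  then show ?thesis
    by (subst measurable_cong[OF correlation_average_eq_moved]) (simp_all add: space_eq)
qed

end

text \<open>The expected averages do not depend on R, so their limit is the moment; dominated
  convergence shows that it is also the almost sure constant limit.\<close>

lemma expectation_prod_eq_correlation:
  assumes "AE \<xi> in \<mu>. has_correlation w n \<xi> \<gamma>"
    and small: "\<And>j k. j \<le> n \<Longrightarrow> b j $ k - a j $ k \<le> r"
  shows "(\<integral>\<xi>. (\<Prod>j\<in>{0..n}. weighted w \<xi> (box (a j) (b j))) \<partial>\<mu>) = \<gamma> (box_overlap n a b)"
proof -
  \<comment> \<open>The radii 1 + k tend to infinity and are at least 1, as the dominating bound
    demands.\<close>
  let ?c = "\<lambda>k \<xi>. correlation_average w n \<xi> (box_overlap n a b) (1 + real k)"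
  let ?E = "\<integral>\<xi>. (\<Prod>j\<in>{0..n}. weighted w \<xi> (box (a j) (b j))) \<partial>\<mu>"
  have E: "(\<integral>\<xi>. ?c k \<xi> \<partial>\<mu>) = ?E" for k
    by (rule expectation_correlation_average[OF small]) auto
  have "(\<lambda>k. \<integral>\<xi>. ?c k \<xi> \<partial>\<mu>) \<longlonglongrightarrow> (\<integral>\<xi>. \<gamma> (box_overlap n a b) \<partial>\<mu>)"
  proof (rule integral_dominated_convergence)
    show "?c k \<in> borel_measurable \<mu>" for k
      by (rule measurable_correlation_average[OF small]) auto
    show "AE \<xi> in \<mu>. (\<lambda>k. ?c k \<xi>) \<longlonglongrightarrow> \<gamma> (box_overlap n a b)"
      using assms(1)
    proof (rule AE_mp, intro AE_I2 impI)
      fix \<xi> assume "has_correlation w n \<xi> \<gamma>"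
      then have "(correlation_average w n \<xi> (box_overlap n a b) \<longlongrightarrow> \<gamma> (box_overlap n a b)) at_top"
        using box_overlap_Cc by (auto simp: has_correlation_def)
      moreover have "filterlim (\<lambda>k. 1 + real k) at_top sequentially"
        by (intro filterlim_tendsto_add_at_top[OF tendsto_const] filterlim_real_sequentially)
      ultimately show "(\<lambda>k. ?c k \<xi>) \<longlonglongrightarrow> \<gamma> (box_overlap n a b)"
        by (rule filterlim_compose)
    qed
    have "\<bar>?c k \<xi>\<bar> \<le> bound w n * (\<bar>r\<bar> + 1) ^ CARD('d)" if "\<xi> \<in> \<Omega>" for k \<xi>
      by (rule abs_correlation_average_le[OF small _ that]) auto
    then show "AE \<xi> in \<mu>. norm (?c k \<xi>) \<le> bound w n * (\<bar>r\<bar> + 1) ^ CARD('d)" for k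
      using AE_\<Omega> by (auto elim!: eventually_mono)
  qed auto
  then have "(\<lambda>k. ?E) \<longlonglongrightarrow> \<gamma> (box_overlap n a b)"
    unfolding E by (simp add: prob_space)
  then show ?thesis by (simp add: LIMSEQ_const_iff)
qed

end

section \<open>From moments to hitting probabilities\<close>

text \<open>This is the Lagrange basis polynomial of the node w i, divided by its weight squared to
  compensate for the extra factor x^2. The normalising constant is nonzero because the weights are
  distinct and w i is not 0; the factor x^2 makes the whole expression vanish at 0, the value of an
  empty box.\<close>

lemma Lagrange_basis_square:
  fixes w :: "'m::finite \<Rightarrow> real"
  assumes "inj w" "\<forall>i. w i \<noteq> 0"
  shows "\<exists>p. \<forall>j. w j ^ 2 * poly p (w j) = of_bool (j = i)"
proof -
  define c where "c = w i ^ 2 * (\<Prod>j\<in>UNIV - {i}. w i - w j)"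
  have "c \<noteq> 0"
    using assms by (auto simp: c_def inj_def)
  define p where "p = smult (inverse c) (\<Prod>j\<in>UNIV - {i}. [:- w j, 1:])"
  have *: "poly p x = inverse c * (\<Prod>j\<in>UNIV - {i}. x - w j)" for x
    by (simp add: p_def poly_prod)
  have "w j ^ 2 * poly p (w j) = of_bool (j = i)" for j
  proof (cases "j = i")
    case True
    then have "w j ^ 2 * poly p (w j) = inverse c * c" by (simp add: * c_def)
    then show ?thesis using True \<open>c \<noteq> 0\<close> by simp
  next
    case False
    then have "(\<Prod>l\<in>UNIV - {i}. w j - w l) = 0" by (intro prod_zero) auto
    then show ?thesis using False by (simp add: *)
  qed
  then show ?thesis by blast
qed

lemma abs_prod_list_le:
  fixes f :: "'a \<Rightarrow> real"
  assumes "\<And>x. x \<in> set xs \<Longrightarrow> \<bar>f x\<bar> \<le> W" "0 \<le> W"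
  shows "\<bar>prod_list (map f xs)\<bar> \<le> W ^ length xs"
  using assms(1)
proof (induction xs)
  case (Cons x xs)
  then have "\<bar>f x\<bar> * \<bar>prod_list (map f xs)\<bar> \<le> W * W ^ length xs"
    using assms(2) by (intro mult_mono) auto
  then show ?case by (simp add: abs_mult)
qed simp

lemma prod_list_of_bool:
  "prod_list (map (\<lambda>x. of_bool (Q x)) xs) = (of_bool (\<forall>x\<in>set xs. Q x) :: real)"
  by (induction xs) auto

definition box_hit :: "('d::finite, 'm) site measure \<Rightarrow> (real ^ 'd) \<times> (real ^ 'd) \<times> 'm \<Rightarrow> bool" where
  "box_hit \<xi> l = (case l of (a, b, i) \<Rightarrow> emeasure \<xi> (box a b \<times> {i}) \<noteq> 0)"

definition small_box :: "real \<Rightarrow> (real ^ 'd::finite) \<times> (real ^ 'd) \<Rightarrow> bool" where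
  "small_box r B \<longleftrightarrow> (\<forall>k. snd B $ k - fst B $ k \<le> r)"

text \<open>Mixed moments are the intermediate stage of an induction that trades the hit indicators,
  one at a time, for powers of weighted masses. Lists are used because boxes then occur with
  multiplicity.\<close>

definition hit_moment ::
    "('m \<Rightarrow> real) \<Rightarrow> ((real ^ 'd::finite) \<times> (real ^ 'd) \<times> 'm) list \<Rightarrow> ((real ^ 'd) \<times> (real ^ 'd)) list \<Rightarrow>
     ('d, 'm::{finite,discrete_topology}) site measure \<Rightarrow> real" where
  "hit_moment w Ls Bs \<xi> = prod_list (map (\<lambda>l. of_bool (box_hit \<xi> l)) Ls) *
     prod_list (map (\<lambda>(a, b). weighted w \<xi> (box a b)) Bs)"

context stationary_hard_core
begin

lemma measurable_box_hit: "Measurable.pred \<mu> (\<lambda>\<xi>. box_hit \<xi> l)"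
proof -
  obtain a b i where l: "l = (a, b, i)" by (metis prod_cases3)
  have [measurable]: "(\<lambda>\<xi>. emeasure \<xi> (box a b \<times> {i})) \<in> borel_measurable \<mu>"
    using borel_measurable_fixed_box_count[of a b i] measurable_cong_sets[OF sets_eq refl] by blast
  show ?thesis unfolding box_hit_def l prod.case by measurable
qed

lemma measurable_hit_moment: "hit_moment w Ls Bs \<in> borel_measurable \<mu>"
proof -
  note [measurable] = measurable_box_hit measurable_weighted_box
  have "(\<lambda>\<xi>. prod_list (map (\<lambda>l. of_bool (box_hit \<xi> l)) Ls) :: real) \<in> borel_measurable \<mu>"
    by (induction Ls) simp_all
  moreover have "(\<lambda>\<xi>. prod_list (map (\<lambda>(a, b). weighted w \<xi> (box a b)) Bs)) \<in> borel_measurable \<mu>"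
    by (induction Bs) (simp_all add: case_prod_beta)
  ultimately show ?thesis unfolding hit_moment_def[abs_def] by measurable
qed

lemma integrable_hit_moment:
  assumes "\<And>B. B \<in> set Bs \<Longrightarrow> small_box r B"
  shows "integrable \<mu> (hit_moment w Ls Bs)"
proof (rule integrable_const_bound)
  let ?W = "\<Sum>i\<in>UNIV. \<bar>w i\<bar>"
  have W: "0 \<le> ?W" by (intro sum_nonneg) simp
  have "\<bar>hit_moment w Ls Bs \<xi>\<bar> \<le> ?W ^ length Bs" if "\<xi> \<in> \<Omega>" for \<xi>
  proof -
    have "\<bar>prod_list (map (\<lambda>(a, b). weighted w \<xi> (box a b)) Bs)\<bar> \<le> ?W ^ length Bs"
      using assms W abs_weighted_box_le[OF that]
      by (intro abs_prod_list_le) (auto simp: small_box_def)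
    moreover have "\<bar>prod_list (map (\<lambda>l. of_bool (box_hit \<xi> l)) Ls) :: real\<bar> \<le> 1 ^ length Ls"
      by (intro abs_prod_list_le) auto
    ultimately show ?thesis
      unfolding hit_moment_def abs_mult using mult_mono[of _ 1 _ "?W ^ length Bs"] by fastforce
  qed
  then show "AE \<xi> in \<mu>. norm (hit_moment w Ls Bs \<xi>) \<le> ?W ^ length Bs"
    using AE_\<Omega> by (auto elim!: eventually_mono)
qed (rule measurable_hit_moment)

text \<open>A product of N box masses belongs to the N-point correlation, whose index is N - 1; the
  head of the list acts as the reference point. Correlations begin at index 1, hence the lower bound
  on the length.\<close>

lemma expectation_weighted_boxes:
  assumes "\<forall>n\<ge>1. AE \<xi> in \<mu>. has_correlation w n \<xi> (\<gamma> n)"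
    and "\<And>B. B \<in> set Bs \<Longrightarrow> small_box r B" and "length Bs \<ge> 2"
  shows "(\<integral>\<xi>. hit_moment w [] Bs \<xi> \<partial>\<mu>) =
    \<gamma> (length Bs - 1) (box_overlap (length Bs - 1) (\<lambda>j. fst (Bs ! j)) (\<lambda>j. snd (Bs ! j)))"
proof -
  have "{0..<length Bs} = {0..length Bs - 1}" using assms(3) by auto
  then have "hit_moment w [] Bs \<xi> = (\<Prod>j\<in>{0..length Bs - 1}. weighted w \<xi> (box (fst (Bs ! j)) (snd (Bs ! j))))" for \<xi>
    using assms(3) by (auto simp: hit_moment_def prod.list_conv_set_nth case_prod_beta intro!: prod.cong)
  then show ?thesis
    using assms by (simp add: small_box_def, intro expectation_prod_eq_correlation) auto
qed

text \<open>The mass of a small box takes values in \<open>{0} \<union> range w\<close>, and every function on this set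
  that vanishes at \<open>0\<close> is a polynomial divisible by the square of the variable.  The square keeps all
  moments at degree at least two, where the correlations start.\<close>

lemma expectation_hit_moment_Cons:
  assumes p: "\<forall>j. w j ^ 2 * poly p (w j) = of_bool (j = i)"
    and B: "small_box r (a, b)" and Bs: "\<And>B. B \<in> set Bs \<Longrightarrow> small_box r B"
  shows "(\<integral>\<xi>. hit_moment w ((a, b, i) # Ls) Bs \<xi> \<partial>\<mu>) =
    (\<Sum>k\<le>degree p. coeff p k * (\<integral>\<xi>. hit_moment w Ls (replicate (k + 2) (a, b) @ Bs) \<xi> \<partial>\<mu>))"
proof -
  have small: "b $ k - a $ k \<le> r" for k using B by (simp add: small_box_def)
  have hit: "of_bool (box_hit \<xi> (a, b, i)) = (\<Sum>k\<le>degree p. coeff p k * weighted w \<xi> (box a b) ^ (k + 2))"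
    if "\<xi> \<in> \<Omega>" for \<xi>
  proof -
    have \<xi>: "\<xi> \<in> unif_discrete r" using that \<Omega>_subset by blast
    let ?v = "weighted w \<xi> (box a b)"
    have "(\<Sum>k\<le>degree p. coeff p k * ?v ^ (k + 2)) = ?v ^ 2 * poly p ?v"
      by (simp add: poly_altdef sum_distrib_left power_add power2_eq_square algebra_simps)
    also have "\<dots> = of_bool (box_hit \<xi> (a, b, i))"
    proof (cases "\<exists>j. emeasure \<xi> (box a b \<times> {j}) \<noteq> 0")
      \<comment> \<open>Exactly one colour j occupies the box, so the mass is w j and the polynomial
        tests whether j is i. For an empty box the mass is 0 and the square annihilates the
        polynomial.\<close>
      case True
      then obtain j where j: "emeasure \<xi> (box a b \<times> {j}) \<noteq> 0" by blast
      have "box_hit \<xi> (a, b, i) \<longleftrightarrow> j = i"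
        using emeasure_small_box(2)[OF \<xi> small j, of i] j by (auto simp: box_hit_def)
      then show ?thesis using p weighted_small_box(1)[OF \<xi> small j] by simp
    next
      case False
      then show ?thesis using weighted_small_box(2)[OF \<xi> small, of w] by (simp add: box_hit_def)
    qed
    finally show ?thesis by simp
  qed
  have "(\<integral>\<xi>. hit_moment w ((a, b, i) # Ls) Bs \<xi> \<partial>\<mu>) =
      (\<integral>\<xi>. (\<Sum>k\<le>degree p. coeff p k * hit_moment w Ls (replicate (k + 2) (a, b) @ Bs) \<xi>) \<partial>\<mu>)"
  proof (rule integral_cong_AE)
    show "AE \<xi> in \<mu>. hit_moment w ((a, b, i) # Ls) Bs \<xi> =
        (\<Sum>k\<le>degree p. coeff p k * hit_moment w Ls (replicate (k + 2) (a, b) @ Bs) \<xi>)"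
      using AE_\<Omega>
    proof (rule eventually_mono)
      fix \<xi> assume "\<xi> \<in> \<Omega>"
      then show "hit_moment w ((a, b, i) # Ls) Bs \<xi> =
          (\<Sum>k\<le>degree p. coeff p k * hit_moment w Ls (replicate (k + 2) (a, b) @ Bs) \<xi>)"
        by (simp add: hit_moment_def hit sum_distrib_left sum_distrib_right prod_list_replicate algebra_simps)
    qed
  qed (intro borel_measurable_sum borel_measurable_times borel_measurable_const measurable_hit_moment)+
  also have "\<dots> = (\<Sum>k\<le>degree p. \<integral>\<xi>. coeff p k * hit_moment w Ls (replicate (k + 2) (a, b) @ Bs) \<xi> \<partial>\<mu>)"
    using B Bs by (intro Bochner_Integration.integral_sum integrable_mult_right integrable_hit_moment) auto
  finally show ?thesis by simp
qed

end

text \<open>Removing one hit indicator prepends at least two copies of its box to Bs. The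
  alternative "at least two or none" is therefore kept by the induction, and a single weighted box
  never occurs. With both lists empty the moment is the total mass 1.\<close>

lemma expectation_hit_moment_eq:
  assumes \<mu>: "stationary_hard_core \<mu> r \<Omega>" and \<mu>': "stationary_hard_core \<mu>' r \<Omega>"
    and w: "inj w" "\<forall>i. w i \<noteq> 0"
    and c: "\<forall>n\<ge>1. AE \<xi> in \<mu>. has_correlation w n \<xi> (\<gamma> n)"
    and c': "\<forall>n\<ge>1. AE \<xi> in \<mu>'. has_correlation w n \<xi> (\<gamma>' n)"
    and eq: "\<forall>n\<ge>1. \<forall>f\<in>Cc (tuples n). \<gamma>' n f = \<gamma> n f"
    and small: "\<And>a b i. (a, b, i) \<in> set Ls \<Longrightarrow> small_box r (a, b)" "\<And>B. B \<in> set Bs \<Longrightarrow> small_box r B"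
    and "length Bs \<ge> 2 \<or> Bs = []"
  shows "(\<integral>\<xi>. hit_moment w Ls Bs \<xi> \<partial>\<mu>') = (\<integral>\<xi>. hit_moment w Ls Bs \<xi> \<partial>\<mu>)"
proof -
  interpret M: stationary_hard_core \<mu> r \<Omega> by fact
  interpret M': stationary_hard_core \<mu>' r \<Omega> by fact
  show ?thesis
    using small assms(10)
  proof (induction Ls arbitrary: Bs)
    case Nil
    show ?case
    proof (cases "Bs = []")
      case True
      then show ?thesis by (simp add: hit_moment_def M.prob_space M'.prob_space)
    next
      case False
      then have "length Bs \<ge> 2" "length Bs - 1 \<ge> 1" using Nil by auto
      then show ?thesis
        using M.expectation_weighted_boxes[OF c Nil(2)] M'.expectation_weighted_boxes[OF c' Nil(2)] eq box_overlap_Cc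
        by metis
    qed
  next
    case (Cons l Ls)
    obtain a b i where l: "l = (a, b, i)" by (metis prod_cases3)
    obtain p where p: "\<forall>j. w j ^ 2 * poly p (w j) = of_bool (j = i)"
      using Lagrange_basis_square[OF w] by blast
    have B: "small_box r (a, b)" using Cons.prems(1) l by auto
    have "(\<integral>\<xi>. hit_moment w Ls (replicate (k + 2) (a, b) @ Bs) \<xi> \<partial>\<mu>') =
        (\<integral>\<xi>. hit_moment w Ls (replicate (k + 2) (a, b) @ Bs) \<xi> \<partial>\<mu>)" for k
      using Cons.prems B by (intro Cons.IH) auto
    then show ?case
      unfolding l
      by (simp only: M.expectation_hit_moment_Cons[OF p B Cons.prems(2)]
        M'.expectation_hit_moment_Cons[OF p B Cons.prems(2)])
  qed
qed

section \<open>Hitting events generate the vague Borel sets\<close>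

lemma small_rational_box:
  fixes x :: "real ^ 'd::finite"
  assumes "\<rho> > 0"
  obtains a b where "a \<in> rational_vectors" "b \<in> rational_vectors" "x \<in> box a b"
    "box a b \<subseteq> ball x \<rho>" "small_box \<rho> (a, b)"
proof -
  \<comment> \<open>The norm is at most the sum of the coordinates in absolute value, hence at most
    CARD('d) times \<delta>, which is \<rho>/2; the edges are shorter than 2\<delta> \<le>
    \<rho>.\<close>
  define \<delta> where "\<delta> = \<rho> / (2 * real CARD('d))"
  have \<delta>: "\<delta> > 0" "real CARD('d) * \<delta> < \<rho>" "2 * \<delta> \<le> \<rho>"
    using assms zero_less_card_finite[where 'a='d] by (auto simp: \<delta>_def field_simps)
  obtain a where a: "a \<in> rational_vectors" "\<forall>k. x $ k - \<delta> < a $ k \<and> a $ k < x $ k"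
    using rational_vector_between[of "\<lambda>k. x $ k - \<delta>" "\<lambda>k. x $ k"] \<delta>(1) by auto
  obtain b where b: "b \<in> rational_vectors" "\<forall>k. x $ k < b $ k \<and> b $ k < x $ k + \<delta>"
    using rational_vector_between[of "\<lambda>k. x $ k" "\<lambda>k. x $ k + \<delta>"] \<delta>(1) by auto
  have "box a b \<subseteq> ball x \<rho>"
  proof
    fix y assume "y \<in> box a b"
    then have y: "a $ k < y $ k" "y $ k < b $ k" for k by (auto simp: mem_box_cart)
    have "\<bar>(x - y) $ k\<bar> \<le> \<delta>" for k
      using y[of k] a(2)[rule_format, of k] b(2)[rule_format, of k]
      unfolding vector_minus_component by linarith
    then have "(\<Sum>k\<in>UNIV. \<bar>(x - y) $ k\<bar>) \<le> real CARD('d) * \<delta>"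
      using sum_bounded_above[of UNIV "\<lambda>k. \<bar>(x - y) $ k\<bar>" \<delta>] by simp
    then have "norm (x - y) < \<rho>" using norm_le_l1_cart[of "x - y"] \<delta>(2) by linarith
    then show "y \<in> ball x \<rho>" by (simp add: dist_norm)
  qed
  moreover have "small_box \<rho> (a, b)"
    unfolding small_box_def
  proof
    fix k
    show "snd (a, b) $ k - fst (a, b) $ k \<le> \<rho>"
      using a(2)[rule_format, of k] b(2)[rule_format, of k] \<delta>(3) by simp
  qed
  ultimately show thesis using a b by (intro that[of a b]) (auto simp: mem_box_cart)
qed

lemma small_box_mono: "small_box r B \<Longrightarrow> r \<le> s \<Longrightarrow> small_box s B"
  unfolding small_box_def using order_trans by blast

text \<open>A set of mass 1 acts like a single atom: the integral over it is within e of a value c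
  from which f deviates on the set by at most e. It is applied to a hit box, with c the value of f
  at the reference atom, so the exact position of the atom in the new configuration is
  immaterial.\<close>

lemma integral_near_atom:
  fixes f :: "'a \<Rightarrow> real"
  assumes A: "A \<in> sets M" "emeasure M A = 1" and f[measurable]: "f \<in> borel_measurable M"
    and near: "\<And>x. x \<in> A \<Longrightarrow> \<bar>f x - c\<bar> \<le> e"
  shows "integrable M (\<lambda>x. indicator A x * f x)"
    and "\<bar>(\<integral>x. indicator A x * f x \<partial>M) - c\<bar> \<le> e"
proof -
  note [measurable] = A(1)
  have iA: "integrable M (indicator A :: 'a \<Rightarrow> real)"
    using A by (intro integrable_real_indicator) auto
  have mA: "measure M A = 1" using A(2) by (simp add: measure_def)
  show i: "integrable M (\<lambda>x. indicator A x * f x)"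
  proof (rule Bochner_Integration.integrable_bound)
    show "integrable M (\<lambda>x. (\<bar>c\<bar> + e) * indicator A x)" using iA by (rule integrable_mult_right)
    show "AE x in M. norm (indicator A x * f x) \<le> norm ((\<bar>c\<bar> + e) * indicator A x)"
    proof (rule AE_I2)
      fix x show "norm (indicator A x * f x) \<le> norm ((\<bar>c\<bar> + e) * indicator A x)"
        using near[of x] by (cases "x \<in> A") auto
    qed
  qed measurable
  have "(\<integral>x. indicator A x * f x \<partial>M) - c = (\<integral>x. indicator A x * f x - c * indicator A x \<partial>M)"
    using i iA A(1) mA by (subst Bochner_Integration.integral_diff) (auto simp: integral_indicator sets.Int_space_eq2)
  also have "\<bar>\<dots>\<bar> \<le> (\<integral>x. e * indicator A x \<partial>M)"
  proof (intro order_trans[OF integral_abs_bound] integral_mono' integrable_mult_right iA)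
    fix x assume "x \<in> space M"
    show "\<bar>indicator A x * f x - c * indicator A x\<bar> \<le> e * indicator A x" "0 \<le> e * indicator A x"
      using near[of x] by (cases "x \<in> A"; auto)+
  qed
  also have "\<dots> = e" using mA A(1) by (simp add: sets.Int_space_eq2)
  finally show "\<bar>(\<integral>x. indicator A x * f x \<partial>M) - c\<bar> \<le> e" .
qed

definition hit_event where
  "hit_event \<Omega> Ls = {\<xi> \<in> \<Omega>. \<forall>l\<in>set Ls. box_hit \<xi> l}"

text \<open>Describing vague neighbourhoods takes misses as well as hits, whereas the
  intersection-stable generator consists of hits alone; misses are recovered by complements.\<close>

definition hit_miss_event where
  "hit_miss_event \<Omega> Ls Ms = {\<xi> \<in> \<Omega>. (\<forall>l\<in>set Ls. box_hit \<xi> l) \<and> (\<forall>l\<in>set Ms. \<not> box_hit \<xi> l)}"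

definition coloured_boxes :: "real \<Rightarrow> ((real ^ 'd::finite) \<times> (real ^ 'd) \<times> 'm) set" where
  "coloured_boxes r = {(a, b, i). small_box r (a, b)}"

definition rational_boxes :: "real \<Rightarrow> ((real ^ 'd::finite) \<times> (real ^ 'd) \<times> 'm) set" where
  "rational_boxes r = coloured_boxes r \<inter> rational_vectors \<times> rational_vectors \<times> UNIV"

lemma countable_rational_boxes:
  "countable (rational_boxes r :: ((real ^ 'd::finite) \<times> (real ^ 'd) \<times> 'm::finite) set)"
  unfolding rational_boxes_def
  by (intro countable_Int2 countable_SIGMA countable_rational_vectors countable_finite) simp

lemma point_measure_atom_ge_1:
  fixes \<xi> :: "('d::finite, 'm::{finite,discrete_topology}) site measure"
  assumes "\<xi> \<in> point_measures" "emeasure \<xi> {p} \<noteq> 0"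
  shows "1 \<le> emeasure \<xi> {p}"
  using nat_point_measure[OF assms(1), of "{p}" "{p}"] Nats_ennreal_less_1[of "emeasure \<xi> {p}"] assms(2)
  by (force simp: borel_closed)

text \<open>If two boxes of edge at most r/2 shared a point x, then p and q would both lie in the
  cube of edge r centred at x. Each has mass at least 1, against a total of at most 1.\<close>

lemma unif_discrete_separated:
  fixes \<xi> :: "('d::finite, 'm::{finite,discrete_topology}) site measure"
  assumes \<xi>: "\<xi> \<in> unif_discrete r"
    and pq: "emeasure \<xi> {p} \<noteq> 0" "emeasure \<xi> {q} \<noteq> 0" "p \<noteq> q"
    and B: "small_box (r / 2) (a, b)" "small_box (r / 2) (a', b')"
    and "fst p \<in> box a b" "fst q \<in> box a' b'"
  shows "box a b \<inter> box a' b' = {}"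
proof (rule ccontr)
  assume "\<not> ?thesis"
  then obtain x where x: "x \<in> box a b" "x \<in> box a' b'" by blast
  have pm: "\<xi> \<in> point_measures" using \<xi> by (simp add: unif_discrete_def)
  have *: "y \<in> (+) x ` cube r" if "x \<in> box c d" "y \<in> box c d" "small_box (r / 2) (c, d)" for y c d
  proof -
    have "y - x \<in> cube r"
      unfolding cube_def
    proof (intro CollectI allI)
      fix k
      have "d $ k - c $ k \<le> r / 2" using that(3) by (simp add: small_box_def)
      moreover have "c $ k < x $ k" "x $ k < d $ k" "c $ k < y $ k" "y $ k < d $ k"
        using that(1,2) by (simp_all add: mem_box_cart)
      ultimately show "- (r / 2) < (y - x) $ k \<and> (y - x) $ k < r / 2" by (simp add: minus_less_iff)
    qed
    then show ?thesis by (rule rev_image_eqI) simp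
  qed
  have "{p, q} \<subseteq> (+) x ` cube r \<times> UNIV"
    using *[OF x(1) assms(7) B(1)] *[OF x(2) assms(8) B(2)] by (cases p; cases q) auto
  then have "emeasure \<xi> {p, q} \<le> 1" by (rule emeasure_small_le_1[OF \<xi>])
  moreover have "emeasure \<xi> {p, q} = emeasure \<xi> {p} + emeasure \<xi> {q}"
    using pq(3) plus_emeasure[of "{p}" \<xi> "{q}"] sets_point_measure[OF pm] by (simp add: borel_closed insert_commute)
  moreover have "1 + 1 \<le> emeasure \<xi> {p} + emeasure \<xi> {q}"
    using pq pm by (intro add_mono point_measure_atom_ge_1)
  moreover have "\<not> (1 + 1 \<le> (1::ennreal))" by (simp add: not_le)
  ultimately show False using order_trans[of "1 + 1" "emeasure \<xi> {p} + emeasure \<xi> {q}" 1] by simp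
qed

text \<open>A basic neighbourhood of a configuration is described by finitely many rational boxes: small
  boxes around its points in a compact set are hit, and boxes that cover the rest of this set are
  missed.  By hard-core separation each hit box carries exactly one point.\<close>

lemma hit_miss_neighbourhood:
  fixes \<Omega> :: "('d::finite, 'm::{finite,discrete_topology}) site measure set"
  assumes \<Omega>: "\<Omega> \<subseteq> unif_discrete r" and r: "r > 0" and \<xi>\<^sub>0: "\<xi>\<^sub>0 \<in> \<Omega>"
    and f: "f \<in> Cc euclidean" and U: "open U" "(\<integral>p. f p \<partial>\<xi>\<^sub>0) \<in> U"
  shows "\<exists>Ls\<in>lists (rational_boxes r). \<exists>Ms\<in>lists (rational_boxes r).
    \<xi>\<^sub>0 \<in> hit_miss_event \<Omega> Ls Ms \<and> (\<forall>\<xi>\<in>hit_miss_event \<Omega> Ls Ms. (\<integral>p. f p \<partial>\<xi>) \<in> U)"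
proof -
  have ud: "\<xi>\<^sub>0 \<in> unif_discrete r" using \<Omega> \<xi>\<^sub>0 by blast
  then have pm: "\<xi>\<^sub>0 \<in> point_measures" by (simp add: unif_discrete_def)
  note s0 = sets_point_measure[OF pm]
  define K where "K = closure {p. f p \<noteq> 0}"
  have K: "compact K" using Cc_euclideanD(2)[OF f] by (simp add: K_def)
  have fK: "f p = 0" if "p \<notin> K" for p
    using that closure_subset[of "{p. f p \<noteq> 0}"] by (auto simp: K_def)
  have cont: "continuous_on UNIV f" by (rule Cc_euclideanD(1)[OF f])
  obtain F0 where F0: "finite F0" "F0 \<subseteq> K" "emeasure \<xi>\<^sub>0 (K - F0) = 0"
    using point_measure_finite_atoms[OF pm K] .
  \<comment> \<open>Points of mass 0 are discarded, since a box around such a point need not be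
    hit.\<close>
  define F where "F = {p \<in> F0. emeasure \<xi>\<^sub>0 {p} \<noteq> 0}"
  have F: "finite F" "F \<subseteq> K" using F0 by (auto simp: F_def)
  have F_atom: "emeasure \<xi>\<^sub>0 {p} \<noteq> 0" if "p \<in> F" for p using that by (simp add: F_def)
  have atom_F: "emeasure \<xi>\<^sub>0 {q} = 0" if "q \<in> K" "q \<notin> F" for q
  proof (cases "q \<in> F0")
    case False
    have "K - F0 \<in> sets \<xi>\<^sub>0"
      using s0 borel_compact[OF K] borel_closed[OF finite_imp_closed[OF F0(1)]] by auto
    from emeasure_eq_0[OF this F0(3), of "{q}"] show ?thesis using False that by blast
  qed (use that in \<open>auto simp: F_def\<close>)
  obtain \<epsilon> where \<epsilon>: "\<epsilon> > 0" "ball (\<integral>p. f p \<partial>\<xi>\<^sub>0) \<epsilon> \<subseteq> U"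
    using U by (meson open_contains_ball)
  \<comment> \<open>Each of the two integrals to be compared is within \<open>card F * e\<close> of
    the sum of f over F, so twice this must stay below \<epsilon>. The summand 1 covers an empty
    F.\<close>
  define e where "e = \<epsilon> / (2 * real (card F) + 1)"
  have e: "e > 0" using \<epsilon>(1) by (simp add: e_def)
  have "2 * real (card F) * \<epsilon> < \<epsilon> * (2 * real (card F) + 1)" using \<epsilon>(1) by (simp add: algebra_simps)
  then have e2: "2 * (real (card F) * e) < \<epsilon>"
    unfolding e_def by (simp add: divide_simps mult.commute mult.left_commute)
  have "\<forall>p. \<exists>l. (fst l, fst (snd l), snd p) \<in> rational_boxes r \<and> small_box (r / 2) (fst l, fst (snd l)) \<and>
    fst p \<in> box (fst l) (fst (snd l)) \<and> snd (snd l) = snd p \<and>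
    (\<forall>y\<in>box (fst l) (fst (snd l)). \<bar>f (y, snd p) - f p\<bar> \<le> e)"
  proof
    fix p :: "('d, 'm) site"
    have "continuous_on UNIV (\<lambda>y. f (y, snd p))"
      by (rule continuous_on_compose2[OF cont]) (auto intro!: continuous_intros)
    then obtain d where d: "d > 0" "\<And>y. dist y (fst p) < d \<Longrightarrow> dist (f (y, snd p)) (f (fst p, snd p)) < e"
      unfolding continuous_on_iff using e by (metis UNIV_I)
    obtain a b where ab: "a \<in> rational_vectors" "b \<in> rational_vectors" "fst p \<in> box a b"
      "box a b \<subseteq> ball (fst p) (min d (r / 2))" "small_box (min d (r / 2)) (a, b)"
      using small_rational_box[of "min d (r / 2)" "fst p"] d(1) r by auto
    have sm: "small_box (r / 2) (a, b)" "small_box r (a, b)"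
      by (rule small_box_mono[OF ab(5)], use r in simp)+
    have "\<bar>f (y, snd p) - f p\<bar> \<le> e" if "y \<in> box a b" for y
    proof -
      have "dist y (fst p) < d" using that ab(4) by (auto simp: dist_commute)
      then show ?thesis using d(2)[of y] by (simp add: dist_real_def)
    qed
    then show "\<exists>l. (fst l, fst (snd l), snd p) \<in> rational_boxes r \<and> small_box (r / 2) (fst l, fst (snd l)) \<and>
      fst p \<in> box (fst l) (fst (snd l)) \<and> snd (snd l) = snd p \<and>
      (\<forall>y\<in>box (fst l) (fst (snd l)). \<bar>f (y, snd p) - f p\<bar> \<le> e)"
      using ab sm by (intro exI[of _ "(a, b, snd p)"]) (auto simp: rational_boxes_def coloured_boxes_def)
  qed
  then obtain h where h: "\<forall>p. (fst (h p), fst (snd (h p)), snd p) \<in> rational_boxes r \<and>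
    small_box (r / 2) (fst (h p), fst (snd (h p))) \<and>
    fst p \<in> box (fst (h p)) (fst (snd (h p))) \<and> snd (snd (h p)) = snd p \<and>
    (\<forall>y\<in>box (fst (h p)) (fst (snd (h p))). \<bar>f (y, snd p) - f p\<bar> \<le> e)"
    by metis
  define a where "a p = fst (h p)" for p
  define b where "b p = fst (snd (h p))" for p
  have ab: "(a p, b p, snd p) \<in> rational_boxes r" "small_box (r / 2) (a p, b p)" "fst p \<in> box (a p) (b p)"
    "\<And>y. y \<in> box (a p) (b p) \<Longrightarrow> \<bar>f (y, snd p) - f p\<bar> \<le> e" for p
    using h unfolding a_def b_def by blast+
  define A where "A p = box (a p) (b p) \<times> {snd p}" for p :: "('d, 'm) site"
  have Aopen: "open (A p)" for p
    unfolding A_def by (intro open_Times Topological_Spaces.open_discrete open_box)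
  have pA: "p \<in> A p" for p using ab(3)[of p] by (cases p) (simp add: A_def)
  \<comment> \<open>Removing the open hit boxes keeps the rest compact, so finitely many missed
    boxes suffice to cover it.\<close>
  define K' where "K' = K - (\<Union>p\<in>F. A p)"
  have K': "compact K'" unfolding K'_def by (intro compact_diff K open_UN ballI Aopen)
  have "\<forall>q\<in>K'. \<exists>l\<in>rational_boxes r. \<not> box_hit \<xi>\<^sub>0 l \<and> fst q \<in> box (fst l) (fst (snd l)) \<and> snd (snd l) = snd q"
  proof
    fix q assume "q \<in> K'"
    \<comment> \<open>Every point of F lies in its own hit box, which K' avoids. Thus q has no mass,
      and neither has a small enough box around it.\<close>
    then have "q \<in> K" "q \<notin> F" using pA[of q] by (auto simp only: K'_def)
    then have q0: "emeasure \<xi>\<^sub>0 {q} = 0" by (rule atom_F)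
    obtain d where d: "d > 0" "emeasure \<xi>\<^sub>0 (ball (fst q) d \<times> {snd q} - {q}) = 0"
      using point_measure_isolated[OF pm, of "fst q" "snd q"] by auto
    have bor: "{q} \<in> sets \<xi>\<^sub>0" by (simp add: s0 borel_closed)
    then have "ball (fst q) d \<times> {snd q} - {q} \<in> sets \<xi>\<^sub>0"
      unfolding s0 by (intro sets.Diff Times_colour_borel) auto
    with bor have null: "ball (fst q) d \<times> {snd q} - {q} \<union> {q} \<in> null_sets \<xi>\<^sub>0"
      using d q0 by (intro null_sets.Un) (auto simp: null_sets_def)
    obtain u v where uv: "u \<in> rational_vectors" "v \<in> rational_vectors" "fst q \<in> box u v"
      "box u v \<subseteq> ball (fst q) (min d r)" "small_box (min d r) (u, v)"
      using small_rational_box[of "min d r" "fst q"] d(1) r by auto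
    have "box u v \<times> {snd q} \<subseteq> ball (fst q) d \<times> {snd q} - {q} \<union> {q}" using uv(4) by auto
    then have "emeasure \<xi>\<^sub>0 (box u v \<times> {snd q}) = 0"
      using emeasure_eq_0[OF null_setsD2[OF null] null_setsD1[OF null]] by blast
    then show "\<exists>l\<in>rational_boxes r. \<not> box_hit \<xi>\<^sub>0 l \<and> fst q \<in> box (fst l) (fst (snd l)) \<and> snd (snd l) = snd q"
      using uv by (intro bexI[of _ "(u, v, snd q)"])
        (auto simp: box_hit_def rational_boxes_def coloured_boxes_def small_box_def)
  qed
  then have "\<exists>g. \<forall>q\<in>K'. g q \<in> rational_boxes r \<and> \<not> box_hit \<xi>\<^sub>0 (g q) \<and>
      fst q \<in> box (fst (g q)) (fst (snd (g q))) \<and> snd (snd (g q)) = snd q"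
    by (intro bchoice) blast
  then obtain g where g': "\<forall>q\<in>K'. g q \<in> rational_boxes r \<and> \<not> box_hit \<xi>\<^sub>0 (g q) \<and>
      fst q \<in> box (fst (g q)) (fst (snd (g q))) \<and> snd (snd (g q)) = snd q" ..
  have g: "\<And>q. q \<in> K' \<Longrightarrow> g q \<in> rational_boxes r" "\<And>q. q \<in> K' \<Longrightarrow> \<not> box_hit \<xi>\<^sub>0 (g q)"
    "\<And>q. q \<in> K' \<Longrightarrow> q \<in> box (fst (g q)) (fst (snd (g q))) \<times> {snd (snd (g q))}"
    unfolding mem_Times_iff singleton_iff using g' by metis+
  obtain D where D: "D \<subseteq> K'" "finite D" "K' \<subseteq> (\<Union>q\<in>D. box (fst (g q)) (fst (snd (g q))) \<times> {snd (snd (g q))})"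
  proof (rule compactE_image[OF K'])
    show "open (box (fst (g q)) (fst (snd (g q))) \<times> {snd (snd (g q))})" for q
      by (intro open_Times Topological_Spaces.open_discrete open_box)
    show "K' \<subseteq> (\<Union>q\<in>K'. box (fst (g q)) (fst (snd (g q))) \<times> {snd (snd (g q))})"
      using g(3) by blast
  qed blast
  from finite_list[OF finite_imageI[OF F(1), of "\<lambda>p. (a p, b p, snd p)"]]
  obtain Ls where Ls: "set Ls = (\<lambda>p. (a p, b p, snd p)) ` F" ..
  from finite_list[OF finite_imageI[OF D(2), of g]]
  obtain Ms where Ms: "set Ms = g ` D" ..
  have lists: "Ls \<in> lists (rational_boxes r)" "Ms \<in> lists (rational_boxes r)"
    using Ls Ms ab(1) g(1) D(1) by (auto simp: in_lists_conv_set)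
  have disj: "A p \<inter> A q = {}" if "p \<in> F" "q \<in> F" "p \<noteq> q" for p q
    using unif_discrete_separated[OF ud F_atom[OF that(1)] F_atom[OF that(2)] that(3) ab(2) ab(2) ab(3) ab(3)]
    by (auto simp: A_def)
  have mem: "\<xi>\<^sub>0 \<in> hit_miss_event \<Omega> Ls Ms"
  proof -
    have "box_hit \<xi>\<^sub>0 (a p, b p, snd p)" if "p \<in> F" for p
    proof -
      have "emeasure \<xi>\<^sub>0 {p} \<le> emeasure \<xi>\<^sub>0 (A p)"
        using pA Aopen s0 by (intro emeasure_mono) auto
      then show ?thesis using F_atom[OF that] by (auto simp: box_hit_def A_def)
    qed
    then show ?thesis using \<xi>\<^sub>0 Ls Ms g(2) D(1) by (auto simp: hit_miss_event_def)
  qed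
  have approx: "\<bar>(\<integral>p. f p \<partial>\<xi>) - (\<Sum>p\<in>F. f p)\<bar> \<le> real (card F) * e" if \<xi>: "\<xi> \<in> hit_miss_event \<Omega> Ls Ms" for \<xi>
  proof -
    have \<xi>u: "\<xi> \<in> unif_discrete r" using \<xi> \<Omega> by (auto simp: hit_miss_event_def)
    then have \<xi>p: "\<xi> \<in> point_measures" by (simp add: unif_discrete_def)
    note s = sets_point_measure[OF \<xi>p]
    have fm: "f \<in> borel_measurable \<xi>"
      using borel_measurable_continuous_onI[OF cont] s by (simp cong: measurable_cong_sets)
    have A1: "emeasure \<xi> (A p) = 1" if "p \<in> F" for p
    proof -
      have "box_hit \<xi> (a p, b p, snd p)" using \<xi> that Ls by (auto simp: hit_miss_event_def)
      moreover have "b p $ k - a p $ k \<le> r" for k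
        using ab(1)[of p] by (auto simp: rational_boxes_def coloured_boxes_def small_box_def)
      ultimately show ?thesis
        using emeasure_small_box(1)[OF \<xi>u, of "b p" "a p" "snd p"] by (auto simp: box_hit_def A_def)
    qed
    have As: "A p \<in> sets \<xi>" for p using Aopen s by auto
    have near: "\<bar>f x - f p\<bar> \<le> e" if "x \<in> A p" for x p
      using that ab(4)[of "fst x" p] by (cases x) (auto simp: A_def)
    note atom = integral_near_atom[OF As A1 fm near]
    have "(\<Union>q\<in>D. box (fst (g q)) (fst (snd (g q))) \<times> {snd (snd (g q))}) \<in> null_sets \<xi>"
    proof (intro null_sets_UN' countable_finite D(2))
      fix q assume "q \<in> D"
      then have "\<not> box_hit \<xi> (g q)" using \<xi> Ms by (auto simp: hit_miss_event_def)
      then show "box (fst (g q)) (fst (snd (g q))) \<times> {snd (snd (g q))} \<in> null_sets \<xi>"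
        using s by (auto simp: null_sets_def box_hit_def case_prod_beta intro!: Times_colour_borel)
    qed
    \<comment> \<open>The missed boxes cover K', so a configuration in the event has no mass there.
      Outside K' the function f lives on the disjoint hit boxes, and its integral splits into one
      term per box.\<close>
    then have "AE x in \<xi>. x \<notin> K'"
      by (rule AE_mp[OF AE_not_in]) (intro AE_I2 impI, use D(3) in blast)
    then have "AE x in \<xi>. f x = (\<Sum>p\<in>F. indicator (A p) x * f x)"
    proof (rule eventually_mono)
      fix x assume x: "x \<notin> K'"
      show "f x = (\<Sum>p\<in>F. indicator (A p) x * f x)"
      proof (cases "\<exists>p\<in>F. x \<in> A p")
        case True
        then obtain p where p: "p \<in> F" "x \<in> A p" by blast
        have "(\<Sum>q\<in>F. indicator (A q) x * f x) = (\<Sum>q\<in>F. if q = p then f x else 0)"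
          using disj[OF p(1)] p(2) by (intro sum.cong) (auto simp: indicator_def)
        then show ?thesis using p F(1) by simp
      next
        case False
        then have "x \<notin> K" using x by (auto simp: K'_def)
        then show ?thesis using fK by simp
      qed
    qed
    then have "(\<integral>p. f p \<partial>\<xi>) = (\<integral>x. (\<Sum>p\<in>F. indicator (A p) x * f x) \<partial>\<xi>)"
      using fm As by (intro integral_cong_AE) (auto intro!: borel_measurable_sum borel_measurable_times borel_measurable_indicator)
    also have "\<dots> = (\<Sum>p\<in>F. \<integral>x. indicator (A p) x * f x \<partial>\<xi>)"
      by (intro Bochner_Integration.integral_sum atom(1))
    finally have "(\<integral>p. f p \<partial>\<xi>) - (\<Sum>p\<in>F. f p) = (\<Sum>p\<in>F. (\<integral>x. indicator (A p) x * f x \<partial>\<xi>) - f p)"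
      by (simp add: sum_subtractf)
    also have "\<bar>\<dots>\<bar> \<le> (\<Sum>p\<in>F. e)"
      by (intro order_trans[OF sum_abs] sum_mono atom(2))
    finally show ?thesis by simp
  qed
  have "(\<integral>p. f p \<partial>\<xi>) \<in> U" if "\<xi> \<in> hit_miss_event \<Omega> Ls Ms" for \<xi>
  proof -
    \<comment> \<open>The approximation is used for the original configuration too, which belongs to
      its own event.\<close>
    have "dist (\<integral>p. f p \<partial>\<xi>\<^sub>0) (\<integral>p. f p \<partial>\<xi>) < \<epsilon>"
      unfolding dist_real_def using approx[OF that] approx[OF mem] e2 by linarith
    then show ?thesis using \<epsilon>(2) by auto
  qed
  then show ?thesis using lists mem by blast
qed

text \<open>Induction over the generation of the topology extends the neighbourhoods from basic sets
  to all open sets; for intersections it suffices to concatenate the lists.\<close>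

lemma vague_open_hit_miss:
  fixes \<Omega> :: "('d::finite, 'm::{finite,discrete_topology}) site measure set"
  assumes \<Omega>: "\<Omega> \<subseteq> unif_discrete r" and r: "r > 0" and "openin vague U" and "\<xi> \<in> U \<inter> \<Omega>"
  shows "\<exists>Ls\<in>lists (rational_boxes r). \<exists>Ms\<in>lists (rational_boxes r).
    \<xi> \<in> hit_miss_event \<Omega> Ls Ms \<and> hit_miss_event \<Omega> Ls Ms \<subseteq> U"
proof -
  have "generate_topology_on {{\<xi> \<in> point_measures. (\<integral>p. f p \<partial>\<xi>) \<in> U} | f U. f \<in> Cc euclidean \<and> open U} U"
    using assms(3) by (simp add: vague_def openin_topology_generated_by_iff)
  then show ?thesis
    using assms(4)
  proof (induction arbitrary: \<xi> rule: generate_topology_on.induct)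
    case (Int S T)
    obtain L M where 1: "L \<in> lists (rational_boxes r)" "M \<in> lists (rational_boxes r)"
      "\<xi> \<in> hit_miss_event \<Omega> L M" "hit_miss_event \<Omega> L M \<subseteq> S"
      using Int.IH(1)[of \<xi>] Int.prems by blast
    obtain L' M' where 2: "L' \<in> lists (rational_boxes r)" "M' \<in> lists (rational_boxes r)"
      "\<xi> \<in> hit_miss_event \<Omega> L' M'" "hit_miss_event \<Omega> L' M' \<subseteq> T"
      using Int.IH(2)[of \<xi>] Int.prems by blast
    have "hit_miss_event \<Omega> (L @ L') (M @ M') = hit_miss_event \<Omega> L M \<inter> hit_miss_event \<Omega> L' M'"
      by (auto simp: hit_miss_event_def)
    then show ?case using 1 2 by (intro bexI[of _ "L @ L'"] bexI[of _ "M @ M'"]) auto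
  next
    case (UN \<S>)
    then obtain S where "S \<in> \<S>" "\<xi> \<in> S \<inter> \<Omega>" by blast
    then show ?case using UN.IH[of S \<xi>] by blast
  next
    case (Basis S)
    then obtain f V where S: "S = {\<xi> \<in> point_measures. (\<integral>p. f p \<partial>\<xi>) \<in> V}" and f: "f \<in> Cc euclidean" and V: "open V"
      by blast
    have "\<xi> \<in> \<Omega>" "(\<integral>p. f p \<partial>\<xi>) \<in> V" using Basis.prems S by auto
    from hit_miss_neighbourhood[OF \<Omega> r this(1) f V this(2)]
    obtain L M where LM: "L \<in> lists (rational_boxes r)" "M \<in> lists (rational_boxes r)"
      "\<xi> \<in> hit_miss_event \<Omega> L M" "\<And>\<zeta>. \<zeta> \<in> hit_miss_event \<Omega> L M \<Longrightarrow> (\<integral>p. f p \<partial>\<zeta>) \<in> V"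
      by blast
    have "hit_miss_event \<Omega> L M \<subseteq> S"
      using LM(4) \<Omega> by (auto simp: S hit_miss_event_def unif_discrete_def)
    then show ?case using LM by blast
  qed simp
qed

text \<open>Lists of rational boxes are countably many, so the trace of an open set is a countable
  union of hit-miss events, each a hit event minus finitely many others. Conversely, hit events are
  measurable because box counts are.\<close>

lemma sets_restrict_hit_events:
  fixes \<Omega> :: "('d::finite, 'm::{finite,discrete_topology}) site measure set"
  assumes \<Omega>: "\<Omega> \<subseteq> unif_discrete r" "\<Omega> \<in> sets vague_borel" and r: "r > 0" and M: "sets M = sets vague_borel"
  shows "sets (restrict_space M \<Omega>) = sigma_sets \<Omega> (hit_event \<Omega> ` lists (coloured_boxes r))" (is "_ = sigma_sets \<Omega> ?E")
proof -
  have \<Omega>p: "\<Omega> \<subseteq> point_measures" using \<Omega>(1) by (auto simp: unif_discrete_def)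
  have EPow: "?E \<subseteq> Pow \<Omega>" by (auto simp: hit_event_def)
  interpret sigma_algebra \<Omega> "sigma_sets \<Omega> ?E" by (rule sigma_algebra_sigma_sets[OF EPow])
  have hm: "hit_miss_event \<Omega> Ls Ms \<in> sigma_sets \<Omega> ?E"
    if "Ls \<in> lists (rational_boxes r)" "Ms \<in> lists (rational_boxes r)" for Ls Ms
  proof -
    have "Ls \<in> lists (coloured_boxes r)" "\<And>l. l \<in> set Ms \<Longrightarrow> [l] \<in> lists (coloured_boxes r)"
      using that by (auto simp: rational_boxes_def)
    then have "hit_event \<Omega> Ls - (\<Union>l\<in>set Ms. hit_event \<Omega> [l]) \<in> sigma_sets \<Omega> ?E"
      by (intro Diff finite_UN) (auto intro!: sigma_sets.Basic)
    also have "hit_event \<Omega> Ls - (\<Union>l\<in>set Ms. hit_event \<Omega> [l]) = hit_miss_event \<Omega> Ls Ms"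
      by (auto simp: hit_event_def hit_miss_event_def)
    finally show ?thesis .
  qed
  have open_trace: "\<Omega> \<inter> U \<in> sigma_sets \<Omega> ?E" if U: "openin vague U" for U
  proof -
    define \<V> where "\<V> = {V \<in> (\<lambda>(Ls, Ms). hit_miss_event \<Omega> Ls Ms) ` (lists (rational_boxes r) \<times> lists (rational_boxes r)). V \<subseteq> U}"
    have "countable \<V>"
    proof (rule countable_subset)
      show "\<V> \<subseteq> (\<lambda>(Ls, Ms). hit_miss_event \<Omega> Ls Ms) ` (lists (rational_boxes r) \<times> lists (rational_boxes r))"
        by (auto simp: \<V>_def)
    qed (intro countable_image countable_SIGMA countable_lists countable_rational_boxes)
    moreover have "V \<in> sigma_sets \<Omega> ?E" if "V \<in> \<V>" for V using that hm by (auto simp: \<V>_def)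
    ultimately have "\<Union>\<V> \<in> sigma_sets \<Omega> ?E" by (rule sigma_sets_UNION)
    also have "\<Union>\<V> = \<Omega> \<inter> U"
    proof (intro equalityI subsetI)
      fix \<xi> assume "\<xi> \<in> \<Omega> \<inter> U"
      then show "\<xi> \<in> \<Union>\<V>"
        using vague_open_hit_miss[OF \<Omega>(1) r U, of \<xi>] by (force simp: \<V>_def)
    qed (auto simp: \<V>_def hit_miss_event_def)
    finally show ?thesis .
  qed
  have "sets (restrict_space M \<Omega>) = (\<inter>) \<Omega> ` sigma_sets point_measures {U. openin vague U}"
    by (simp add: sets_restrict_space M sets_vague_borel)
  also have "\<dots> = sigma_sets \<Omega> ((\<inter>) \<Omega> ` {U. openin vague U})"
    using \<Omega>(2) \<Omega>p by (intro sigma_sets_Int) (simp_all add: sets_vague_borel)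
  finally have eq: "sets (restrict_space M \<Omega>) = sigma_sets \<Omega> ((\<inter>) \<Omega> ` {U. openin vague U})" .
  show ?thesis
  proof
    show "sets (restrict_space M \<Omega>) \<subseteq> sigma_sets \<Omega> ?E"
      unfolding eq using open_trace by (intro sigma_sets_mono) auto
    have "hit_event \<Omega> Ls \<in> sets (restrict_space M \<Omega>)" for Ls
    proof -
      have 1: "{\<xi> \<in> space vague_borel. box_hit \<xi> l} \<in> sets vague_borel" for l :: "(real ^ 'd) \<times> (real ^ 'd) \<times> 'm"
      proof -
        obtain a b i where l: "l = (a, b, i)" by (metis prod_cases3)
        note [measurable] = borel_measurable_fixed_box_count[of a b i]
        show ?thesis unfolding l box_hit_def prod.case by measurable
      qed
      have "{\<xi> \<in> space vague_borel. \<forall>l\<in>set Ls. box_hit \<xi> l} \<in> sets M"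
        unfolding M by (intro sets.sets_Collect_finite_All 1) auto
      moreover have "hit_event \<Omega> Ls = \<Omega> \<inter> {\<xi> \<in> space vague_borel. \<forall>l\<in>set Ls. box_hit \<xi> l}"
        using \<Omega>p by (auto simp: hit_event_def space_vague_borel)
      ultimately show ?thesis unfolding sets_restrict_space by blast
    qed
    then have "?E \<subseteq> sets (restrict_space M \<Omega>)" by auto
    moreover have "space (restrict_space M \<Omega>) = \<Omega>"
      using \<Omega>p sets_eq_imp_space_eq[OF M] by (auto simp: space_restrict_space space_vague_borel)
    ultimately show "sigma_sets \<Omega> ?E \<subseteq> sets (restrict_space M \<Omega>)"
      using sets.sigma_sets_subset[of ?E "restrict_space M \<Omega>"] by simp
  qed
qed

section \<open>Comparison of the two processes on a common carrier\<close>

lemma (in stationary_hard_core) measure_hit_event: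
  assumes "hit_event \<Omega> Ls \<in> sets \<mu>"
  shows "measure \<mu> (hit_event \<Omega> Ls) = (\<integral>\<xi>. hit_moment w Ls [] \<xi> \<partial>\<mu>)"
proof -
  have "(\<integral>\<xi>. hit_moment w Ls [] \<xi> \<partial>\<mu>) = (\<integral>\<xi>. indicator (hit_event \<Omega> Ls) \<xi> \<partial>\<mu>)"
  proof (rule integral_cong_AE)
    show "AE \<xi> in \<mu>. hit_moment w Ls [] \<xi> = indicator (hit_event \<Omega> Ls) \<xi>"
      using AE_\<Omega> by (auto elim!: eventually_mono simp: hit_moment_def prod_list_of_bool hit_event_def indicator_def)
  qed (use assms measurable_hit_moment in auto)
  then show ?thesis using assms by (simp add: sets.Int_space_eq2)
qed

lemma ergodic_point_process_carrier:
  fixes \<mu> :: "('d::finite, 'm::{finite,discrete_topology}) site measure measure"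
  assumes "ergodic_point_process X \<mu>"
  shows "X \<in> sets vague_borel" "AE \<xi> in \<mu>. \<xi> \<in> X" "\<exists>r>0. X \<subseteq> unif_discrete r"
proof -
  have s: "sets \<mu> = sets vague_borel" and "is_support \<mu> X"
    and r: "\<exists>r>0. closedin (subtopology vague (unif_discrete r)) X"
    using assms by (simp_all add: ergodic_point_process_def)
  then have cl: "closedin vague X" and null: "emeasure \<mu> (point_measures - X) = 0"
    by (simp_all add: is_support_def)
  have "openin vague (point_measures - X)" "X \<subseteq> point_measures"
    using cl by (auto simp: closedin_def topspace_vague)
  then have op: "point_measures - X \<in> sets vague_borel" and X: "X = space vague_borel - (point_measures - X)"
    by (auto simp: sets_vague_borel space_vague_borel)
  show "X \<in> sets vague_borel"
    by (subst X) (intro sets.compl_sets op)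
  have "AE \<xi> in \<mu>. \<xi> \<notin> point_measures - X"
    using null op s by (intro AE_not_in) (auto simp: null_sets_def)
  then show "AE \<xi> in \<mu>. \<xi> \<in> X"
    using sets_eq_imp_space_eq[OF s] by (auto simp: space_vague_borel)
  show "\<exists>r>0. X \<subseteq> unif_discrete r"
    using r closedin_subset by fastforce
qed

theorem theorem5:
  fixes \<mu> \<mu>' :: "('d::finite, 'm::{finite,discrete_topology}) site measure measure"
    and X X' :: "('d, 'm) site measure set"
    and w :: "'m \<Rightarrow> real"
    and \<gamma> \<gamma>' :: "nat \<Rightarrow> ((nat \<Rightarrow> real ^ 'd) \<Rightarrow> real) \<Rightarrow> real"
  assumes "ergodic_point_process X \<mu>"
    and "ergodic_point_process X' \<mu>'"
    and "inj w"
    and "\<forall>i. w i \<noteq> 0"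
    and "\<forall>n\<ge>1. AE \<xi> in \<mu>. has_correlation w n \<xi> (\<gamma> n)"
    and "\<forall>n\<ge>1. AE \<xi> in \<mu>'. has_correlation w n \<xi> (\<gamma>' n)"
    and "\<forall>n\<ge>1. \<forall>f\<in>Cc (tuples n). \<gamma>' n f = \<gamma> n f"
  shows "\<mu>' = \<mu>"
proof -
  define \<Omega> where "\<Omega> = X \<union> X'"
  note X = ergodic_point_process_carrier[OF assms(1)] and X' = ergodic_point_process_carrier[OF assms(2)]
  have s: "sets \<mu> = sets vague_borel" "sets \<mu>' = sets vague_borel"
    using assms(1,2) by (simp_all add: ergodic_point_process_def)
  obtain r\<^sub>1 r\<^sub>2 where "r\<^sub>1 > 0" "X \<subseteq> unif_discrete r\<^sub>1" "r\<^sub>2 > 0" "X' \<subseteq> unif_discrete r\<^sub>2"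
    using X(3) X'(3) by blast
  moreover define r where "r = min r\<^sub>1 r\<^sub>2"
  ultimately have r: "r > 0" and \<Omega>: "\<Omega> \<subseteq> unif_discrete r"
    using unif_discrete_mono[of r r\<^sub>1] unif_discrete_mono[of r r\<^sub>2]
    by (auto simp: \<Omega>_def)
  have \<Omega>s: "\<Omega> \<in> sets vague_borel" using X(1) X'(1) by (auto simp: \<Omega>_def)
  have AE: "AE \<xi> in \<mu>. \<xi> \<in> \<Omega>" "AE \<xi> in \<mu>'. \<xi> \<in> \<Omega>"
    using X(2) X'(2) by (auto simp: \<Omega>_def)
  have M: "stationary_hard_core \<mu> r \<Omega>" and M': "stationary_hard_core \<mu>' r \<Omega>"
    using assms(1,2) s \<Omega> \<Omega>s AE
    by (simp_all add: stationary_hard_core_def stationary_hard_core_axioms_def ergodic_point_process_def)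
  interpret M: stationary_hard_core \<mu> r \<Omega> by fact
  interpret M': stationary_hard_core \<mu>' r \<Omega> by fact
  let ?E = "hit_event \<Omega> ` lists (coloured_boxes r)"
  note gen = sets_restrict_hit_events[OF \<Omega> \<Omega>s r]
  \<comment> \<open>The empty list imposes no condition, so the carrier belongs to the generator and
    serves as its exhausting family.\<close>
  have whole: "\<Omega> = hit_event \<Omega> []" by (auto simp: hit_event_def)
  show ?thesis
  \<comment> \<open>Both measures are concentrated on \<Omega>, so agreement on an
    intersection-stable generator of the trace sigma-algebra is enough.\<close>
  proof (rule measure_eqI_restrict_generator[where E = ?E and \<Omega> = \<Omega> and A = "{\<Omega>}"])
    show "Int_stable ?E"
    proof (rule Int_stableI)
      fix A B assume "A \<in> ?E" "B \<in> ?E"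
      then obtain Ls Ls' where "A = hit_event \<Omega> Ls" "Ls \<in> lists (coloured_boxes r)"
        "B = hit_event \<Omega> Ls'" "Ls' \<in> lists (coloured_boxes r)" by blast
      then show "A \<inter> B \<in> ?E"
        by (intro image_eqI[of _ _ "Ls @ Ls'"]) (auto simp: hit_event_def)
    qed
    show "emeasure \<mu>' A = emeasure \<mu> A" if A_mem: "A \<in> ?E" for A
    proof -
      obtain Ls where Ls: "A = hit_event \<Omega> Ls" "Ls \<in> lists (coloured_boxes r)" using A_mem by blast
      have "A \<in> sets (restrict_space \<mu> \<Omega>)"
        using A_mem gen[OF s(1)] by auto
      then have A: "A \<in> sets \<mu>" "A \<in> sets \<mu>'"
        using \<Omega>s s by (auto simp: sets_restrict_space)
      have "small_box r (a, b)" if "(a, b, i) \<in> set Ls" for a b i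
        using Ls(2) that by (auto simp: in_lists_conv_set coloured_boxes_def)
      then have "(\<integral>\<xi>. hit_moment w Ls [] \<xi> \<partial>\<mu>') = (\<integral>\<xi>. hit_moment w Ls [] \<xi> \<partial>\<mu>)"
        by (intro expectation_hit_moment_eq[OF M M' assms(3-7)]) auto
      then show ?thesis
        using A M.measure_hit_event[of Ls w] M'.measure_hit_event[of Ls w]
        by (simp add: Ls(1) M.emeasure_eq_measure M'.emeasure_eq_measure)
    qed
    show "{\<Omega>} \<subseteq> ?E" using whole by auto
  qed (use s \<Omega>s AE gen[OF s(1)] gen[OF s(2)] in \<open>auto simp: hit_event_def\<close>)
qed

end
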